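(* Suppose that $q_0$ is locally polyhedral with constants $\epsilon,L>0$ independent of $V$, i.e. for all $\boldsymbol U\succeq\boldsymbol 0$ with $\|\boldsymbol U-\boldsymbol U_0^*\|<\epsilon$, $$q_0(\boldsymbol U_0^* )\ge q_0(\boldsymbol U)+L\|\boldsymbol U_0^*-\boldsymbol U\|.$$ Then under QLA with parameter $V\ge 1$: (a) There exist constants $\nu>0$ and $D\ge\eta>0$, all independent of $V$, with $D=D(\nu)$ and $\eta=\eta(\nu)$, such that whenever $\|\boldsymbol U(t)-\boldsymbol U_V^*\|\ge D$, $$\mathbb E\{\|\boldsymbol U(t+T_\nu)-\boldsymbol U_V^*\|\mid \boldsymbol U(t)\}\le\|\boldsymbol U(t)-\boldsymbol U_V^*\|-\eta .$$ In particular, $\nu,D,\eta$ can be chosen as follows: choose $\nu$ as any constant with $0<\nu<L/B$, then $\eta$ as any value with $0<\eta<T_\nu(L-B\nu)$, and finally $$D=\max\left[\frac{(T_\nu^2+T_\nu)B^2-\eta^2}{2T_\nu\left(L-\frac{\eta}{T_\nu}-B\nu\right)},\ \eta\right].$$ (b) For given constants $\nu,D,\eta$ as in (a), there exist constants $c^*,\beta^*>0$, independent of $V$, such that for all $m\ge 0$ $$\mathcal P(D,m)\le c^*e^{-\beta^*m},\qquad \mathcal P(D,m)\triangleq\limsup_{t\to\infty}\frac1t\sum_{\tau=0}^{t-1}\Pr\{\|\boldsymbol U(\tau)-\boldsymbol U_V^*\|>D+m\}.$$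
   Context: Network model. Time is slotted, $t=0,1,2,\dots$; there are $r\ge1$ queues. The network state $S(t)$ takes values in a finite set $\mathcal S=\{s_1,\dots,s_M\}$ and evolves as a time-homogeneous (ergodic) Markov process with steady-state probabilities $p_{s_i}$. When $S(t)=s_i$, the controller observes $s_i$ and chooses an action $x$ in a compact feasible set $\mathcal X^{(s_i)}$; this incurs cost $f(t)=f(s_i,x)$ (the function $f$ is either everywhere nonnegative or everywhere nonpositive), arrivals $A_j(t)=g_j(s_i,x)\ge0$ to queue $j$ and service $\mu_j(t)=b_j(s_i,x)\ge0$ of queue $j$, $j=1,\dots,r$. The magnitudes of $f,g_j,b_j$ are bounded by a constant $\delta_{max}\in(0,\infty)$. Slackness: there are actions $x^{(s_i)k}\in\mathcal X^{(s_i)}$, $k=1,\dots,r+2$, and weights $\vartheta_k^{(s_i)}\ge0$ with $\sum_k\vartheta_k^{(s_i)}=1$ for each $s_i$, and some $\epsilon_s>0$, such that $\sum_{s_i}p_{s_i}\sum_k\vartheta_k^{(s_i)}[g_j(s_i,x^{(s_i)k})-b_j(s_i,x^{(s_i)k})]\le-\epsilon_s$ for all $j$. The backlog vector $\boldsymbol U(t)=(U_1(t),\dots,U_r(t))^T$ satisfies $\boldsymbol U(0)=\boldsymbol 0$ and $U_j(t+1)=\max[U_j(t)-\mu_j(t),0]+A_j(t)$. Put $B=\sqrt r\,\delta_{max}$. $\|\cdot\|$ is the Euclidean norm, $\succeq$ is entrywise. QLA with parameter $V\ge1$: at each slot $t$, given $\boldsymbol U(t)$ and $S(t)=s_i$,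 choose $x\in\mathcal X^{(s_i)}$ maximizing $-Vf(s_i,x)+\sum_jU_j(t)[b_j(s_i,x)-g_j(s_i,x)]$. Dual function: $q(\boldsymbol U)=\inf_{x^{(s_i)}\in\mathcal X^{(s_i)}}\sum_{s_i}p_{s_i}\{Vf(s_i,x^{(s_i)})+\sum_jU_j[g_j(s_i,x^{(s_i)})-b_j(s_i,x^{(s_i)})]\}$; $\boldsymbol U_V^*$ denotes the maximizer of $q$ over $\boldsymbol U\succeq\boldsymbol 0$, assumed unique for every $V\ge1$. $q_0$ and $\boldsymbol U_0^*$ denote $q$ and its maximizer when $V=1$. Convergent interval: for $t_0\ge 0$ and $k\ge1$, $\mathcal T_{s_i}(t_0,k)$ is the set of slots $\tau\in[t_0,t_0+k-1]$ with $S(\tau)=s_i$, and $\|\mathcal T_{s_i}(t_0,k)\|$ is its cardinality; $\mathcal H(t_0)=\{S(\tau)\}_{\tau=0}^{t_0-1}$. For $\nu>0$, $T_\nu$ is the smallest number of slots such that for any $t_0$, regardless of past history, $\sum_{i=1}^M\left|p_{s_i}-\frac{\mathbb E\{\|\mathcal T_{s_i}(t_0,T_\nu)\|\mid\mathcal H(t_0)\}}{T_\nu}\right|\le\nu$; $T_\nu$ is finite for every $\nu>0$. *)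

theory Defs
  imports "HOL-Probability.Probability"
begin

section \<open>Static network data\<close>

record ('s, 'a, 'r) network =
  feasible :: "'s \<Rightarrow> 'a set"
  cost :: "'s \<Rightarrow> 'a \<Rightarrow> real"
  arrival :: "'s \<Rightarrow> 'a \<Rightarrow> real ^ 'r"
  service :: "'s \<Rightarrow> 'a \<Rightarrow> real ^ 'r"

text \<open>No continuity of \<open>cost\<close>, \<open>arrival\<close> and \<open>service\<close> in the action is required; that the
  maximum defining an action of QLA is attained is part of \<open>qla_run\<close> below.\<close>

definition bounded_network ::
  "('s, 'a :: topological_space, 'r :: finite) network \<Rightarrow> real \<Rightarrow> bool" where
  "bounded_network N \<delta> \<longleftrightarrow>
     \<delta> > 0 \<and>
     (\<forall>s. compact (feasible N s)) \<and>
     ((\<forall>s. \<forall>x\<in>feasible N s. cost N s x \<ge> 0) \<or> (\<forall>s. \<forall>x\<in>feasible N s. cost N s x \<le> 0)) \<and>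
     (\<forall>s. \<forall>x\<in>feasible N s. \<bar>cost N s x\<bar> \<le> \<delta> \<and>
        (\<forall>j. 0 \<le> arrival N s x $ j \<and> arrival N s x $ j \<le> \<delta> \<and>
             0 \<le> service N s x $ j \<and> service N s x $ j \<le> \<delta>))"

definition slackness ::
  "('s :: finite, 'a, 'r :: finite) network \<Rightarrow> ('s \<Rightarrow> real) \<Rightarrow> bool" where
  "slackness N p \<longleftrightarrow>
     (\<exists>(y :: 's \<Rightarrow> nat \<Rightarrow> 'a) (\<theta> :: 's \<Rightarrow> nat \<Rightarrow> real) (\<epsilon>\<^sub>s :: real). \<epsilon>\<^sub>s > 0 \<and>
        (\<forall>s. \<forall>k\<in>{1..CARD('r) + 2}. y s k \<in> feasible N s \<and> \<theta> s k \<ge> 0) \<and>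
        (\<forall>s. (\<Sum>k=1..CARD('r) + 2. \<theta> s k) = 1) \<and>
        (\<forall>j. (\<Sum>s\<in>UNIV. p s * (\<Sum>k=1..CARD('r) + 2.
               \<theta> s k * (arrival N s (y s k) $ j - service N s (y s k) $ j))) \<le> - \<epsilon>\<^sub>s))"

section \<open>Dual function\<close>

definition dual ::
  "('s :: finite, 'a, 'r :: finite) network \<Rightarrow> ('s \<Rightarrow> real) \<Rightarrow> real \<Rightarrow> real ^ 'r \<Rightarrow> real" where
  "dual N p V U =
     (INF y\<in>{y. \<forall>s. y s \<in> feasible N s}.
        \<Sum>s\<in>UNIV. p s * (V * cost N s (y s) +
          (\<Sum>j\<in>UNIV. U $ j * (arrival N s (y s) $ j - service N s (y s) $ j))))"

definition unique_dual_maximizer ::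
  "('s :: finite, 'a, 'r :: finite) network \<Rightarrow> ('s \<Rightarrow> real) \<Rightarrow> real \<Rightarrow> bool" where
  "unique_dual_maximizer N p V \<longleftrightarrow> (\<exists>!U. is_arg_max (dual N p V) (\<lambda>U. 0 \<le> U) U)"

definition U_star ::
  "('s :: finite, 'a, 'r :: finite) network \<Rightarrow> ('s \<Rightarrow> real) \<Rightarrow> real \<Rightarrow> real ^ 'r" where
  "U_star N p V = arg_max (dual N p V) (\<lambda>U. 0 \<le> U)"

definition locally_polyhedral ::
  "(real ^ 'r :: finite \<Rightarrow> real) \<Rightarrow> real ^ 'r \<Rightarrow> real \<Rightarrow> real \<Rightarrow> bool" where
  "locally_polyhedral q U0 \<epsilon> L \<longleftrightarrow>
     (\<forall>U\<ge>0. norm (U - U0) < \<epsilon> \<longrightarrow> q U0 \<ge> q U + L * norm (U0 - U))"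

section \<open>The network state process\<close>

primrec n_step :: "('s :: finite \<Rightarrow> 's \<Rightarrow> real) \<Rightarrow> nat \<Rightarrow> 's \<Rightarrow> 's \<Rightarrow> real" where
  "n_step P 0 s s' = (if s = s' then 1 else 0)"
| "n_step P (Suc n) s s' = (\<Sum>u\<in>UNIV. P s u * n_step P n u s')"

definition ergodic_kernel ::
  "('s :: finite \<Rightarrow> 's \<Rightarrow> real) \<Rightarrow> ('s \<Rightarrow> real) \<Rightarrow> bool" where
  "ergodic_kernel P p \<longleftrightarrow>
     (\<forall>s s'. P s s' \<ge> 0) \<and> (\<forall>s. (\<Sum>s'\<in>UNIV. P s s') = 1) \<and>
     (\<forall>s s'. \<exists>n. n_step P n s s' > 0) \<and>
     (\<forall>s. Gcd {n. n \<ge> 1 \<and> n_step P n s s > 0} = 1) \<and>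
     (\<forall>s. p s \<ge> 0) \<and> (\<Sum>s\<in>UNIV. p s) = 1 \<and>
     (\<forall>s'. p s' = (\<Sum>s\<in>UNIV. p s * P s s'))"

text \<open>\<open>F t\<close> is the information available once the action of slot \<open>t\<close> has been taken. Stating the
  Markov property relative to a filtration, rather than only relative to the past of \<open>S\<close>, lets a
  controller break ties at random, but not by looking into the future of \<open>S\<close>. The natural
  filtration of \<open>S\<close> is one possible choice of \<open>F\<close>. The law of \<open>S 0\<close> is arbitrary.\<close>

definition markov_state_process ::
  "'w measure \<Rightarrow> (nat \<Rightarrow> 'w measure) \<Rightarrow> (nat \<Rightarrow> 'w \<Rightarrow> 's :: finite) \<Rightarrow> ('s \<Rightarrow> 's \<Rightarrow> real) \<Rightarrow> bool"
where
  "markov_state_process M F S P \<longleftrightarrow>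
     prob_space M \<and> filtration (space M) F \<and> (\<forall>t. subalgebra M (F t)) \<and>
     (\<forall>t. S t \<in> F t \<rightarrow>\<^sub>M count_space UNIV) \<and>
     (\<forall>t s'. AE \<omega> in M.
        real_cond_exp M (F t) (indicator {\<omega> \<in> space M. S (Suc t) \<omega> = s'}) \<omega> = P (S t \<omega>) s')"

section \<open>Convergent intervals\<close>

definition cond_expect_given ::
  "'w measure \<Rightarrow> 'b measure \<Rightarrow> ('w \<Rightarrow> 'b) \<Rightarrow> ('w \<Rightarrow> real) \<Rightarrow> 'w \<Rightarrow> real" where
  "cond_expect_given M K Y Z = real_cond_exp M (vimage_algebra (space M) Y K) Z"

definition history :: "(nat \<Rightarrow> 'w \<Rightarrow> 's) \<Rightarrow> nat \<Rightarrow> 'w \<Rightarrow> 's list" where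
  "history S t0 \<omega> = map (\<lambda>\<tau>. S \<tau> \<omega>) [0..<t0]"

definition slots_in_state :: "(nat \<Rightarrow> 'w \<Rightarrow> 's) \<Rightarrow> 's \<Rightarrow> nat \<Rightarrow> nat \<Rightarrow> 'w \<Rightarrow> nat set" where
  "slots_in_state S s t0 k \<omega> = {\<tau>. t0 \<le> \<tau> \<and> \<tau> < t0 + k \<and> S \<tau> \<omega> = s}"

definition convergent_length ::
  "'w measure \<Rightarrow> (nat \<Rightarrow> 'w \<Rightarrow> 's :: finite) \<Rightarrow> ('s \<Rightarrow> real) \<Rightarrow> real \<Rightarrow> nat \<Rightarrow> bool" where
  "convergent_length M S p \<nu> k \<longleftrightarrow> k \<ge> 1 \<and>
     (\<forall>t0. AE \<omega> in M.
        (\<Sum>s\<in>UNIV. \<bar>p s - cond_expect_given M (count_space UNIV) (history S t0)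
            (\<lambda>\<omega>'. real (card (slots_in_state S s t0 k \<omega>'))) \<omega> / real k\<bar>) \<le> \<nu>)"

definition T_nu ::
  "'w measure \<Rightarrow> (nat \<Rightarrow> 'w \<Rightarrow> 's :: finite) \<Rightarrow> ('s \<Rightarrow> real) \<Rightarrow> real \<Rightarrow> nat" where
  "T_nu M S p \<nu> = (LEAST k. convergent_length M S p \<nu> k)"

section \<open>QLA\<close>

text \<open>\<open>x t \<omega>\<close> is the action taken in slot \<open>t\<close>; the maximizer is arbitrary when it is not unique.\<close>

definition qla_run ::
  "'w measure \<Rightarrow> (nat \<Rightarrow> 'w measure) \<Rightarrow> (nat \<Rightarrow> 'w \<Rightarrow> 's :: finite) \<Rightarrow>
   ('s, 'a, 'r :: finite) network \<Rightarrow> real \<Rightarrow>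
   (nat \<Rightarrow> 'w \<Rightarrow> 'a) \<Rightarrow> (nat \<Rightarrow> 'w \<Rightarrow> real ^ 'r) \<Rightarrow> bool" where
  "qla_run M F S N V x U \<longleftrightarrow>
     (\<forall>t. (\<lambda>\<omega>. arrival N (S t \<omega>) (x t \<omega>)) \<in> borel_measurable (F t) \<and>
          (\<lambda>\<omega>. service N (S t \<omega>) (x t \<omega>)) \<in> borel_measurable (F t)) \<and>
     (\<forall>\<omega>\<in>space M. U 0 \<omega> = 0 \<and>
        (\<forall>t. is_arg_max
               (\<lambda>z. - V * cost N (S t \<omega>) z +
                  (\<Sum>j\<in>UNIV. U t \<omega> $ j * (service N (S t \<omega>) z $ j - arrival N (S t \<omega>) z $ j)))
               (\<lambda>z. z \<in> feasible N (S t \<omega>)) (x t \<omega>) \<and>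
             (\<forall>j. U (Suc t) \<omega> $ j =
                max (U t \<omega> $ j - service N (S t \<omega>) (x t \<omega>) $ j) 0
                  + arrival N (S t \<omega>) (x t \<omega>) $ j)))"

text \<open>\<open>V\<close> and the run of QLA are quantified inside the predicate: \<open>\<nu>\<close>, \<open>D\<close>, \<open>\<eta>\<close> depend neither on
  \<open>V\<close> nor on the tie-breaking.\<close>

definition drift_condition ::
  "'w measure \<Rightarrow> (nat \<Rightarrow> 'w measure) \<Rightarrow> (nat \<Rightarrow> 'w \<Rightarrow> 's :: finite) \<Rightarrow> ('s \<Rightarrow> real) \<Rightarrow>
   ('s, 'a, 'r :: finite) network \<Rightarrow> real \<Rightarrow> real \<Rightarrow> real \<Rightarrow> bool" where
  "drift_condition M F S p N \<nu> D \<eta> \<longleftrightarrow>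
     (\<forall>V\<ge>1. \<forall>x U. qla_run M F S N V x U \<longrightarrow>
        (\<forall>t. AE \<omega> in M. norm (U t \<omega> - U_star N p V) \<ge> D \<longrightarrow>
           cond_expect_given M borel (U t)
               (\<lambda>\<omega>'. norm (U (t + T_nu M S p \<nu>) \<omega>' - U_star N p V)) \<omega>
             \<le> norm (U t \<omega> - U_star N p V) - \<eta>))"

definition deviation_freq ::
  "'w measure \<Rightarrow> (nat \<Rightarrow> 'w \<Rightarrow> real ^ 'r :: finite) \<Rightarrow> real ^ 'r \<Rightarrow> real \<Rightarrow> real \<Rightarrow> ereal" where
  "deviation_freq M U Us D m =
     limsup (\<lambda>t. ereal (1 / real t *
       (\<Sum>\<tau><t. measure M {\<omega> \<in> space M. norm (U \<tau> \<omega> - Us) > D + m})))"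

end

theory Submission
  imports Defs
begin

text \<open>
  Write \<open>U*\<close> for the maximizer of the dual function for parameter \<open>V\<close> and
  \<open>Y t = \<parallel>U t - U*\<parallel>\<close>.

  \<^bold>\<open>Why the distance drifts down.\<close> The dual function is a mixture \<open>q = (\<Sum>s. p s * q\<^sub>s)\<close> of one
  concave function \<open>q\<^sub>s\<close> for each network state (\<open>state_dual\<close>, \<open>dual_eq_sum_state_dual\<close>). An action
  of QLA attains the infimum that defines \<open>q\<^sub>s\<close> at the current backlog, so its net input
  (arrivals minus service) is a supergradient of \<open>q\<^sub>s\<close> there, and one slot of QLA is a step of
  stochastic supergradient ascent: \<open>(Y t)\<^sup>2\<close> changes by at most
  \<open>B\<^sup>2 + 2 (q\<^sub>s (U t) - q\<^sub>s (U*))\<close> with \<open>s = S t\<close> (\<open>qla_one_slot\<close>). Since \<open>q\<^sub>s\<close> is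
  \<open>B\<close>-Lipschitz and the backlog moves by at most \<open>B\<close> per slot, the backlog inside \<open>q\<^sub>s\<close> can be frozen at
  its value at the start of a window of \<open>k\<close> slots; all errors together amount to \<open>k\<^sup>2 B\<^sup>2\<close>
  (\<open>qla_many_slots\<close>). What remains depends on the states in the window only through the number of visits to
  each of them. Given the past, these are close to \<open>k * p s\<close> when the window is convergent
  (\<open>occupation_near_stationary\<close>), so the expected sum is close to \<open>k (q (U t) - q (U*))\<close>, up to
  \<open>k B \<nu> Y t\<close>.

  Local polyhedrality makes this difference at most \<open>- L * Y t\<close>: concavity extends it from a
  neighbourhood of the maximizer to all nonnegative backlogs, and the scaling
  \<open>q\<^sub>V (V U) = V q\<^sub>1 U\<close> transports it to every \<open>V\<close> with the same \<open>L\<close>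
  (\<open>dual_polyhedral\<close>). Hence the conditional mean of \<open>(Y (t + k))\<^sup>2\<close> is at most
  \<open>(Y t)\<^sup>2 + k\<^sup>2 B\<^sup>2 - 2 k (L - B \<nu>) Y t\<close>, which is at most \<open>(Y t - \<eta>)\<^sup>2\<close>
  once \<open>Y t\<close> is large, and Jensen's inequality turns this into the drift of \<open>Y\<close> itself (\<open>qla_drift\<close>).

  \<^bold>\<open>Why the tail is exponential.\<close> The increments of \<open>Y\<close> over a window are bounded by
  \<open>K = k B\<close>. For small \<open>w\<close> a second-order expansion of \<open>exp (w Y)\<close> therefore turns the drift
  into a contraction of the exponential moment, up to a constant
  (\<open>exp_moment_drift\<close>). Averaging that recursion over time removes the initial distance, which is the only
  quantity that depends on \<open>V\<close>, and the Markov inequality gives the tail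
  (\<open>deviation_freq_bound\<close>).
\<close>

section \<open>The dual function of a single network state\<close>

lemma norm_le_of_components:
  fixes x :: "real ^ 'r :: finite"
  assumes "\<And>j. \<bar>x $ j\<bar> \<le> \<delta>"
  shows "norm x \<le> sqrt (real CARD('r)) * \<delta>"
proof -
  have d: "0 \<le> \<delta>" using assms[of undefined] by linarith
  have "(\<Sum>j\<in>UNIV. (norm (x $ j))\<^sup>2) \<le> (\<Sum>j\<in>(UNIV :: 'r set). \<delta>\<^sup>2)"
    by (intro sum_mono power_mono) (use assms in auto)
  then have "norm x \<le> sqrt (real CARD('r) * \<delta>\<^sup>2)"
    by (simp add: norm_vec_def L2_set_def)
  also have "\<dots> = sqrt (real CARD('r)) * \<delta>"
    using d by (simp add: real_sqrt_mult)
  finally show ?thesis .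
qed

text \<open>The contribution of one network state to the dual function: the infimum over joint choices of
  actions in \<open>dual\<close> decouples into one such infimum per state.\<close>

definition state_dual ::
  "('s, 'a, 'r :: finite) network \<Rightarrow> real \<Rightarrow> 's \<Rightarrow> real ^ 'r \<Rightarrow> real" where
  "state_dual N V s U =
     (INF x\<in>feasible N s. V * cost N s x + U \<bullet> (arrival N s x - service N s x))"

lemma U_star_is_arg_max:
  assumes "unique_dual_maximizer N p V"
  shows "is_arg_max (dual N p V) (\<lambda>U. 0 \<le> U) (U_star N p V)"
  using assms unfolding unique_dual_maximizer_def U_star_def arg_max_def by (metis someI_ex)

lemma power2_norm_vec: "(norm x)\<^sup>2 = (\<Sum>j\<in>UNIV. (x $ j)\<^sup>2)" for x :: "real ^ 'r :: finite"
  by (simp add: norm_vec_def L2_set_def sum_nonneg)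

locale feasible_network =
  fixes N :: "('s :: finite, 'a :: topological_space, 'r :: finite) network" and \<delta> B :: real
  assumes bounded: "bounded_network N \<delta>"
    and feasible_nonempty: "feasible N s \<noteq> {}"
    and B_eq: "B = sqrt (real CARD('r)) * \<delta>"
begin

lemma delta_pos: "0 < \<delta>" and B_pos: "0 < B"
  using bounded by (simp_all add: bounded_network_def B_eq)

lemma cost_bound: "x \<in> feasible N s \<Longrightarrow> \<bar>cost N s x\<bar> \<le> \<delta>"
  using bounded by (simp add: bounded_network_def)

lemma flow_bounds:
  assumes "x \<in> feasible N s"
  shows "0 \<le> arrival N s x $ j" "arrival N s x $ j \<le> \<delta>"
    "0 \<le> service N s x $ j" "service N s x $ j \<le> \<delta>"
  using bounded assms by (simp_all add: bounded_network_def)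

lemma norm_net_input:
  assumes "x \<in> feasible N s"
  shows "norm (arrival N s x - service N s x) \<le> B"
  unfolding B_eq
proof (rule norm_le_of_components)
  fix j
  show "\<bar>(arrival N s x - service N s x) $ j\<bar> \<le> \<delta>"
    using flow_bounds[OF assms, of j] by (simp add: abs_le_iff)
qed

lemma inner_net_input:
  assumes "x \<in> feasible N s"
  shows "\<bar>U \<bullet> (arrival N s x - service N s x)\<bar> \<le> norm U * B"
  by (meson Cauchy_Schwarz_ineq2 mult_left_mono norm_ge_zero norm_net_input[OF assms] order_trans)

lemma state_dual_bdd_below:
  "bdd_below ((\<lambda>x. V * cost N s x + U \<bullet> (arrival N s x - service N s x)) ` feasible N s)"
proof (rule bdd_belowI2)
  fix x assume x: "x \<in> feasible N s"
  have "\<bar>V * cost N s x\<bar> \<le> \<bar>V\<bar> * \<delta>"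
    using cost_bound[OF x] by (simp add: abs_mult mult_left_mono)
  then show "- (\<bar>V\<bar> * \<delta>) - norm U * B \<le> V * cost N s x + U \<bullet> (arrival N s x - service N s x)"
    using inner_net_input[OF x, of U] by linarith
qed

lemma state_dual_le:
  assumes "x \<in> feasible N s"
  shows "state_dual N V s U \<le> V * cost N s x + U \<bullet> (arrival N s x - service N s x)"
  unfolding state_dual_def by (rule cINF_lower[OF state_dual_bdd_below assms])

lemma state_dual_greatest:
  assumes "\<And>x. x \<in> feasible N s \<Longrightarrow> c \<le> V * cost N s x + U \<bullet> (arrival N s x - service N s x)"
  shows "c \<le> state_dual N V s U"
  unfolding state_dual_def by (rule cINF_greatest[OF feasible_nonempty assms])

lemma state_dual_Lipschitz: "\<bar>state_dual N V s U - state_dual N V s W\<bar> \<le> B * norm (U - W)"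
proof -
  have *: "state_dual N V s W - B * norm (U - W) \<le> state_dual N V s U" for U W
  proof (rule state_dual_greatest)
    fix x assume x: "x \<in> feasible N s"
    have "\<bar>(U - W) \<bullet> (arrival N s x - service N s x)\<bar> \<le> B * norm (U - W)"
      using inner_net_input[OF x, of "U - W"] by (simp add: mult.commute)
    then show "state_dual N V s W - B * norm (U - W)
        \<le> V * cost N s x + U \<bullet> (arrival N s x - service N s x)"
      using state_dual_le[OF x, of V W] by (simp add: inner_diff_left)
  qed
  show ?thesis using *[of W U] *[of U W] by (simp add: norm_minus_commute)
qed

lemma state_dual_continuous: "continuous_on UNIV (state_dual N V s)"
proof (rule lipschitz_on_continuous_on)
  show "B-lipschitz_on UNIV (state_dual N V s)"
    using state_dual_Lipschitz B_pos by (auto simp: lipschitz_on_def dist_real_def dist_norm)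
qed

lemma state_dual_concave:
  assumes "0 \<le> u" "u \<le> 1"
  shows "(1 - u) * state_dual N V s U + u * state_dual N V s W
    \<le> state_dual N V s ((1 - u) *\<^sub>R U + u *\<^sub>R W)"
proof (rule state_dual_greatest)
  fix x assume x: "x \<in> feasible N s"
  have "(1 - u) * state_dual N V s U + u * state_dual N V s W
     \<le> (1 - u) * (V * cost N s x + U \<bullet> (arrival N s x - service N s x))
       + u * (V * cost N s x + W \<bullet> (arrival N s x - service N s x))"
    using assms by (intro add_mono mult_left_mono state_dual_le[OF x]) auto
  then show "(1 - u) * state_dual N V s U + u * state_dual N V s W
     \<le> V * cost N s x + ((1 - u) *\<^sub>R U + u *\<^sub>R W) \<bullet> (arrival N s x - service N s x)"
    by (simp add: inner_add_left algebra_simps)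
qed

text \<open>Dividing the backlog by \<open>V\<close> reduces every parameter to \<open>V = 1\<close>; this is what makes all constants
  independent of \<open>V\<close>.\<close>

lemma state_dual_scale:
  assumes "0 < V"
  shows "state_dual N V s (V *\<^sub>R U) = V * state_dual N 1 s U"
proof (rule antisym)
  have "state_dual N V s (V *\<^sub>R U) / V \<le> state_dual N 1 s U"
  proof (rule state_dual_greatest)
    fix x assume "x \<in> feasible N s"
    from state_dual_le[OF this, of V "V *\<^sub>R U"] assms
    show "state_dual N V s (V *\<^sub>R U) / V \<le> 1 * cost N s x + U \<bullet> (arrival N s x - service N s x)"
      by (simp add: divide_simps) (simp add: algebra_simps)
  qed
  then show "state_dual N V s (V *\<^sub>R U) \<le> V * state_dual N 1 s U"
    using assms by (simp add: pos_divide_le_eq mult.commute)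
  show "V * state_dual N 1 s U \<le> state_dual N V s (V *\<^sub>R U)"
  proof (rule state_dual_greatest)
    fix x assume "x \<in> feasible N s"
    from mult_left_mono[OF state_dual_le[OF this, of 1 U], of V] assms
    show "V * state_dual N 1 s U
        \<le> V * cost N s x + (V *\<^sub>R U) \<bullet> (arrival N s x - service N s x)"
      by (simp add: algebra_simps)
  qed
qed

section \<open>Geometry of the dual function\<close>

text \<open>No infimum need be attained, so the upper bound uses actions that are \<open>e'\<close>-optimal in each state.\<close>

lemma dual_eq_sum_state_dual:
  assumes p: "\<And>s. 0 \<le> p s"
  shows "dual N p V U = (\<Sum>s\<in>UNIV. p s * state_dual N V s U)"
proof -
  define h where "h s x = V * cost N s x + U \<bullet> (arrival N s x - service N s x)" for s x
  define Y where "Y = {y. \<forall>s. y s \<in> feasible N s}"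
  have dual: "dual N p V U = (INF y\<in>Y. \<Sum>s\<in>UNIV. p s * h s (y s))"
    by (simp add: dual_def h_def Y_def inner_vec_def)
  have ne: "Y \<noteq> {}"
    using feasible_nonempty unfolding Y_def by (auto simp: ex_in_conv intro!: choice)
  have lower: "(\<Sum>s\<in>UNIV. p s * state_dual N V s U) \<le> (\<Sum>s\<in>UNIV. p s * h s (y s))" if "y \<in> Y" for y
    using that p state_dual_le unfolding h_def Y_def by (intro sum_mono mult_left_mono) auto
  have "(INF y\<in>Y. \<Sum>s\<in>UNIV. p s * h s (y s)) \<le> (\<Sum>s\<in>UNIV. p s * state_dual N V s U)"
  proof (rule field_le_epsilon)
    fix e :: real assume e: "0 < e"
    \<comment> \<open>the \<open>1 +\<close> keeps the denominator positive\<close>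
    define e' where "e' = e / (1 + (\<Sum>s\<in>UNIV. p s))"
    have S: "0 \<le> (\<Sum>s\<in>UNIV. p s)" by (simp add: p sum_nonneg)
    then have e': "0 < e'" using e by (simp add: e'_def)
    have "\<exists>x\<in>feasible N s. h s x < state_dual N V s U + e'" for s
      using cINF_less_iff[OF feasible_nonempty state_dual_bdd_below[of V s U], of "state_dual N V s U + e'"] e'
      by (simp add: h_def state_dual_def)
    then obtain y where y: "\<And>s. y s \<in> feasible N s" "\<And>s. h s (y s) < state_dual N V s U + e'"
      by metis
    have "(INF y\<in>Y. \<Sum>s\<in>UNIV. p s * h s (y s)) \<le> (\<Sum>s\<in>UNIV. p s * h s (y s))"
      using lower y by (intro cINF_lower bdd_belowI2) (auto simp: Y_def)
    also have "\<dots> \<le> (\<Sum>s\<in>UNIV. p s * (state_dual N V s U + e'))"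
      using p y(2) by (intro sum_mono mult_left_mono) (auto intro: less_imp_le)
    also have "\<dots> = (\<Sum>s\<in>UNIV. p s * state_dual N V s U) + (\<Sum>s\<in>UNIV. p s) * e'"
      by (simp add: distrib_left sum.distrib sum_distrib_right)
    also have "(\<Sum>s\<in>UNIV. p s) * e' \<le> e"
      using S e by (simp add: e'_def divide_simps)
    finally show "(INF y\<in>Y. \<Sum>s\<in>UNIV. p s * h s (y s)) \<le> (\<Sum>s\<in>UNIV. p s * state_dual N V s U) + e"
      by simp
  qed
  moreover have "(\<Sum>s\<in>UNIV. p s * state_dual N V s U) \<le> (INF y\<in>Y. \<Sum>s\<in>UNIV. p s * h s (y s))"
    using ne lower by (rule cINF_greatest)
  ultimately show ?thesis unfolding dual by simp
qed

lemma U_star_scale: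
  assumes p: "\<And>s. 0 \<le> p s" and V: "1 \<le> V"
    and u1: "unique_dual_maximizer N p 1" and uV: "unique_dual_maximizer N p V"
  shows "U_star N p V = V *\<^sub>R U_star N p 1"
proof -
  note arg = U_star_is_arg_max
  have scale: "dual N p V (V *\<^sub>R U) = V * dual N p 1 U" for U
    using V by (simp add: dual_eq_sum_state_dual[OF p] state_dual_scale sum_distrib_left mult.left_commute)
  have "is_arg_max (dual N p V) (\<lambda>U. 0 \<le> U) (V *\<^sub>R U_star N p 1)"
    unfolding is_arg_max_linorder
  proof (intro conjI allI impI)
    show "0 \<le> V *\<^sub>R U_star N p 1"
      using arg[OF u1] V by (simp add: is_arg_max_def less_eq_vec_def)
    fix W :: "real ^ 'r" assume W: "0 \<le> W"
    have "0 \<le> (1 / V) *\<^sub>R W" using W V by (simp add: less_eq_vec_def)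
    then have "dual N p 1 ((1 / V) *\<^sub>R W) \<le> dual N p 1 (U_star N p 1)"
      using arg[OF u1] by (simp add: is_arg_max_linorder)
    moreover have "dual N p V W = V * dual N p 1 ((1 / V) *\<^sub>R W)"
      using scale[of "(1 / V) *\<^sub>R W"] V by simp
    ultimately show "dual N p V W \<le> dual N p V (V *\<^sub>R U_star N p 1)"
      using V by (simp add: scale)
  qed
  with arg[OF uV] uV show ?thesis
    unfolding unique_dual_maximizer_def by blast
qed

text \<open>The polyhedral bound is global: for a concave function, the decay along a ray from the maximizer can
  only get steeper, so the slope \<open>L\<close> seen near the maximizer bounds the decay from below
  at every distance. Scaling by \<open>V\<close> stretches the neighbourhood and leaves the slope unchanged.\<close>

lemma dual_polyhedral:
  assumes p: "\<And>s. 0 \<le> p s" and V: "1 \<le> V"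
    and u: "\<And>V. 1 \<le> V \<Longrightarrow> unique_dual_maximizer N p V"
    and \<epsilon>: "0 < \<epsilon>" and lp: "locally_polyhedral (dual N p 1) (U_star N p 1) \<epsilon> L"
    and U: "0 \<le> U"
  shows "dual N p V U - dual N p V (U_star N p V) \<le> - L * norm (U - U_star N p V)"
proof -
  let ?q = "dual N p 1" and ?U0 = "U_star N p 1"
  have star: "U_star N p V = V *\<^sub>R ?U0"
    by (rule U_star_scale[OF p V]) (use u V in auto)
  have scale: "dual N p V (V *\<^sub>R U) = V * ?q U" for U
    using V by (simp add: dual_eq_sum_state_dual[OF p] state_dual_scale sum_distrib_left mult.left_commute)
  have U0: "0 \<le> ?U0"
    using U_star_is_arg_max[OF u[of 1]] by (simp add: is_arg_max_def)
  have global: "?q W - ?q ?U0 \<le> - L * norm (W - ?U0)" if W: "0 \<le> W" for W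
  proof -
    \<comment> \<open>a step along the segment from the maximizer to \<open>W\<close>, short enough to stay in the polyhedral
      neighbourhood\<close>
    define u where "u = min 1 (\<epsilon> / (2 * (norm (W - ?U0) + 1)))"
    have u: "0 < u" "u \<le> 1" using \<epsilon> by (auto simp: u_def add_nonneg_pos)
    define Z where "Z = (1 - u) *\<^sub>R ?U0 + u *\<^sub>R W"
    have Z0: "0 \<le> Z" using U0 W u by (simp add: Z_def less_eq_vec_def)
    have d: "Z - ?U0 = u *\<^sub>R (W - ?U0)" by (simp add: Z_def algebra_simps)
    have nz: "norm (Z - ?U0) = u * norm (W - ?U0)" using u by (simp add: d)
    have "u * norm (W - ?U0) \<le> \<epsilon> / (2 * (norm (W - ?U0) + 1)) * norm (W - ?U0)"
      by (rule mult_right_mono) (auto simp: u_def)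
    also have "\<dots> \<le> \<epsilon> / (2 * (norm (W - ?U0) + 1)) * (norm (W - ?U0) + 1)"
      using \<epsilon> by (intro mult_left_mono) auto
    also have "\<dots> = \<epsilon> / 2" by (simp add: field_simps add_nonneg_eq_0_iff)
    finally have "norm (Z - ?U0) < \<epsilon>" using \<epsilon> nz by simp
    with lp Z0 have "?q Z + L * norm (?U0 - Z) \<le> ?q ?U0"
      unfolding locally_polyhedral_def by simp
    then have 1: "?q Z + u * (L * norm (W - ?U0)) \<le> ?q ?U0"
      by (simp add: norm_minus_commute[of ?U0] nz mult.left_commute)
    have "(1 - u) * ?q ?U0 + u * ?q W
        = (\<Sum>s\<in>UNIV. p s * ((1 - u) * state_dual N 1 s ?U0 + u * state_dual N 1 s W))"
      by (simp add: dual_eq_sum_state_dual[OF p] sum_distrib_left sum.distrib distrib_left mult.left_commute)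
    also have "\<dots> \<le> ?q Z"
      unfolding dual_eq_sum_state_dual[OF p] Z_def
      using u p by (intro sum_mono mult_left_mono state_dual_concave) auto
    finally have "u * (?q W - ?q ?U0) \<le> u * (- L * norm (W - ?U0))"
      using 1 by (simp add: algebra_simps)
    then show ?thesis using u by (simp only: mult_le_cancel_left_pos)
  qed
  define W where "W = (1 / V) *\<^sub>R U"
  have UW: "U = V *\<^sub>R W" using V by (simp add: W_def)
  have "0 \<le> W" using U V by (simp add: W_def less_eq_vec_def)
  from mult_left_mono[OF global[OF this], of V] V
  have "V * ?q W - V * ?q ?U0 \<le> - L * (V * norm (W - ?U0))"
    by (simp add: algebra_simps)
  moreover have "norm (U - V *\<^sub>R ?U0) = V * norm (W - ?U0)"
    using V by (simp add: UW flip: scaleR_diff_right)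
  ultimately show ?thesis by (simp add: star UW scale)
qed

end

section \<open>Pathwise behaviour of the backlog\<close>

text \<open>Without the truncation at zero this is the expansion of a square with \<open>(a - b)\<^sup>2 \<le> \<delta>\<^sup>2\<close>. The
  truncation adds the wasted service \<open>e = b - u\<close>, which changes the square by
  \<open>2 e (a - v) - e\<^sup>2 \<le> 2 e a - e\<^sup>2\<close> because the target \<open>v\<close> is nonnegative; together with
  \<open>(a - b)\<^sup>2\<close> this is at most \<open>(max a b)\<^sup>2\<close>.\<close>

lemma queue_step_sq:
  fixes u v a b \<delta> :: real
  assumes "0 \<le> u" "0 \<le> v" "0 \<le> a" "a \<le> \<delta>" "0 \<le> b" "b \<le> \<delta>"
  shows "(max (u - b) 0 + a - v)\<^sup>2 \<le> (u - v)\<^sup>2 + \<delta>\<^sup>2 + 2 * ((u - v) * (a - b))"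
proof (cases "b \<le> u")
  case True
  have "(a - b)\<^sup>2 \<le> \<delta>\<^sup>2"
    by (rule power2_le_iff_abs_le[THEN iffD2]) (use assms in auto)
  with True show ?thesis by (simp add: max_def power2_eq_square algebra_simps)
next
  case False
  define e where "e = b - u"
  have e: "0 < e" "e \<le> b" using False assms by (auto simp: e_def)
  have "(a - v)\<^sup>2 - (u - v)\<^sup>2 - 2 * ((u - v) * (a - b)) = (a - b)\<^sup>2 + 2 * e * (a - v) - e\<^sup>2"
    by (simp add: e_def power2_eq_square algebra_simps)
  also have "\<dots> \<le> (a - b)\<^sup>2 + 2 * e * a - e\<^sup>2"
    using e assms by (simp add: mult_left_mono)
  also have "\<dots> \<le> \<delta>\<^sup>2"
  proof (cases "a \<le> b")
    case True
    have "2 * e * a - e\<^sup>2 = a\<^sup>2 - (a - e)\<^sup>2" by (simp add: power2_eq_square algebra_simps)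
    then have "(a - b)\<^sup>2 + 2 * e * a - e\<^sup>2 \<le> (a - b)\<^sup>2 + a\<^sup>2" by simp
    also have "\<dots> = b\<^sup>2 - 2 * (a * (b - a))" by (simp add: power2_eq_square algebra_simps)
    also have "\<dots> \<le> b\<^sup>2" using assms True by simp
    also have "\<dots> \<le> \<delta>\<^sup>2" using assms by (simp add: power_mono)
    finally show ?thesis .
  next
    case False
    have "(a - b)\<^sup>2 + 2 * e * a - e\<^sup>2 = a\<^sup>2 - (b - e) * (2 * a - b - e)"
      by (simp add: power2_eq_square algebra_simps)
    also have "\<dots> \<le> a\<^sup>2" using e False by simp
    also have "\<dots> \<le> \<delta>\<^sup>2" using assms by (simp add: power_mono)
    finally show ?thesis .
  qed
  finally show ?thesis using False by (simp add: max_def)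
qed

context feasible_network
begin

text \<open>QLA maximizes the negative of the function minimized in \<open>state_dual\<close>, so its action attains that
  infimum.\<close>

lemma qla_action:
  assumes run: "qla_run M F S N V x U" and \<omega>: "\<omega> \<in> space M"
  shows "x t \<omega> \<in> feasible N (S t \<omega>)"
    and "state_dual N V (S t \<omega>) (U t \<omega>) = V * cost N (S t \<omega>) (x t \<omega>)
      + U t \<omega> \<bullet> (arrival N (S t \<omega>) (x t \<omega>) - service N (S t \<omega>) (x t \<omega>))"
proof -
  let ?s = "S t \<omega>"
  have *: "is_arg_max (\<lambda>z. - V * cost N ?s z +
      (\<Sum>j\<in>UNIV. U t \<omega> $ j * (service N ?s z $ j - arrival N ?s z $ j)))
      (\<lambda>z. z \<in> feasible N ?s) (x t \<omega>)"
    using run \<omega> by (simp add: qla_run_def)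
  have eq: "- V * cost N ?s z + (\<Sum>j\<in>UNIV. U t \<omega> $ j * (service N ?s z $ j - arrival N ?s z $ j))
      = - (V * cost N ?s z + U t \<omega> \<bullet> (arrival N ?s z - service N ?s z))" for z
    by (simp add: inner_vec_def sum_negf[symmetric] algebra_simps)
  show x: "x t \<omega> \<in> feasible N ?s" using * by (simp add: is_arg_max_def)
  have "V * cost N ?s (x t \<omega>) + U t \<omega> \<bullet> (arrival N ?s (x t \<omega>) - service N ?s (x t \<omega>))
      \<le> state_dual N V ?s (U t \<omega>)"
    using * unfolding is_arg_max_linorder eq by (intro state_dual_greatest) auto
  with state_dual_le[OF x, of V "U t \<omega>"]
  show "state_dual N V ?s (U t \<omega>) = V * cost N ?s (x t \<omega>)
      + U t \<omega> \<bullet> (arrival N ?s (x t \<omega>) - service N ?s (x t \<omega>))" by simp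
qed

lemma qla_step:
  assumes "qla_run M F S N V x U" "\<omega> \<in> space M"
  shows "U (Suc t) \<omega> $ j = max (U t \<omega> $ j - service N (S t \<omega>) (x t \<omega>) $ j) 0
                  + arrival N (S t \<omega>) (x t \<omega>) $ j"
  using assms by (simp add: qla_run_def)

lemma qla_backlog_nonneg:
  assumes run: "qla_run M F S N V x U" and \<omega>: "\<omega> \<in> space M"
  shows "0 \<le> U t \<omega>"
proof (cases t)
  case 0
  then show ?thesis using run \<omega> by (simp add: qla_run_def)
next
  case (Suc n)
  then show ?thesis
    using qla_step[OF run \<omega>, of n] flow_bounds(1)[OF qla_action(1)[OF run \<omega>, of n]]
    by (simp add: less_eq_vec_def add_nonneg_nonneg)
qed

lemma qla_increment:
  assumes run: "qla_run M F S N V x U" and \<omega>: "\<omega> \<in> space M"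
  shows "norm (U (t + k) \<omega> - U t \<omega>) \<le> real k * B"
proof (induction k)
  case (Suc k)
  have "norm (U (Suc (t + k)) \<omega> - U (t + k) \<omega>) \<le> B"
    unfolding B_eq
  proof (rule norm_le_of_components)
    fix j
    have "0 \<le> U (t + k) \<omega> $ j"
      using qla_backlog_nonneg[OF run \<omega>, of "t + k"] by (simp add: less_eq_vec_def)
    then show "\<bar>(U (Suc (t + k)) \<omega> - U (t + k) \<omega>) $ j\<bar> \<le> \<delta>"
      using flow_bounds[OF qla_action(1)[OF run \<omega>, of "t + k"], of j]
      by (auto simp: qla_step[OF run \<omega>] max_def abs_le_iff)
  qed
  with Suc norm_triangle_ineq[of "U (Suc (t + k)) \<omega> - U (t + k) \<omega>" "U (t + k) \<omega> - U t \<omega>"]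
  show ?case by (simp add: algebra_simps)
qed simp

text \<open>The queue recursion bounds the change of the squared distance by \<open>B\<^sup>2\<close> plus twice the
  inner product of \<open>U t - W\<close> with the net input. The net input is a supergradient of the concave function
  \<open>state_dual\<close> at \<open>U t\<close>, which bounds the inner product by a difference of its values.\<close>

lemma qla_one_slot:
  assumes run: "qla_run M F S N V x U" and \<omega>: "\<omega> \<in> space M" and W: "0 \<le> W"
  shows "(norm (U (Suc t) \<omega> - W))\<^sup>2 \<le> (norm (U t \<omega> - W))\<^sup>2 + B\<^sup>2
    + 2 * (state_dual N V (S t \<omega>) (U t \<omega>) - state_dual N V (S t \<omega>) W)"
proof -
  let ?s = "S t \<omega>" and ?x = "x t \<omega>"
  let ?d = "arrival N ?s ?x - service N ?s ?x"
  note x = qla_action[OF run \<omega>, of t]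
  have "(norm (U (Suc t) \<omega> - W))\<^sup>2 = (\<Sum>j\<in>UNIV. (U (Suc t) \<omega> $ j - W $ j)\<^sup>2)"
    by (simp add: power2_norm_vec)
  also have "\<dots> \<le> (\<Sum>j\<in>UNIV. (U t \<omega> $ j - W $ j)\<^sup>2 + \<delta>\<^sup>2 + 2 * ((U t \<omega> $ j - W $ j) * ?d $ j))"
  proof (rule sum_mono)
    fix j
    have "0 \<le> U t \<omega> $ j" "0 \<le> W $ j"
      using qla_backlog_nonneg[OF run \<omega>, of t] W by (simp_all add: less_eq_vec_def)
    from queue_step_sq[OF this flow_bounds[OF x(1), of j]]
    show "(U (Suc t) \<omega> $ j - W $ j)\<^sup>2
      \<le> (U t \<omega> $ j - W $ j)\<^sup>2 + \<delta>\<^sup>2 + 2 * ((U t \<omega> $ j - W $ j) * ?d $ j)"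
      by (simp add: qla_step[OF run \<omega>])
  qed
  also have "\<dots> = (norm (U t \<omega> - W))\<^sup>2 + B\<^sup>2 + 2 * ((U t \<omega> - W) \<bullet> ?d)"
    by (simp add: sum.distrib power2_norm_vec inner_vec_def B_eq sum_distrib_left power_mult_distrib)
  also have "(U t \<omega> - W) \<bullet> ?d \<le> state_dual N V ?s (U t \<omega>) - state_dual N V ?s W"
    using state_dual_le[OF x(1), of V W] x(2) by (simp add: inner_diff_left)
  finally show ?thesis by simp
qed

text \<open>Each slot contributes \<open>B\<^sup>2\<close> and, for replacing the current backlog by the one at the start
  of the window, \<open>2 B (i B)\<close> in slot number \<open>i\<close>; since \<open>1 + 2 i = (i + 1)\<^sup>2 - i\<^sup>2\<close>, the total is
  \<open>k\<^sup>2 B\<^sup>2\<close>. Freezing the backlog lets the sum depend on the states only through the number of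
  visits to each of them.\<close>

lemma qla_many_slots:
  assumes run: "qla_run M F S N V x U" and \<omega>: "\<omega> \<in> space M" and W: "0 \<le> W"
  shows "(norm (U (t + k) \<omega> - W))\<^sup>2 \<le> (norm (U t \<omega> - W))\<^sup>2 + (real k)\<^sup>2 * B\<^sup>2
    + 2 * (\<Sum>\<tau>\<in>{t..<t + k}. state_dual N V (S \<tau> \<omega>) (U t \<omega>) - state_dual N V (S \<tau> \<omega>) W)"
proof (induction k)
  case (Suc k)
  let ?q = "state_dual N V (S (t + k) \<omega>)"
  have "?q (U (t + k) \<omega>) - ?q (U t \<omega>) \<le> B * (real k * B)"
    using state_dual_Lipschitz[of V "S (t + k) \<omega>" "U (t + k) \<omega>" "U t \<omega>"]
      mult_left_mono[OF qla_increment[OF run \<omega>, of t k], of B] B_pos by linarith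
  moreover have "(real (Suc k))\<^sup>2 * B\<^sup>2 = (real k)\<^sup>2 * B\<^sup>2 + B\<^sup>2 + 2 * (B * (real k * B))"
    by (simp add: power2_eq_square algebra_simps)
  ultimately show ?case
    using Suc qla_one_slot[OF run \<omega> W, of "t + k"] by simp
qed simp

end

section \<open>Visits of the state process in a window\<close>

locale state_process =
  fixes M :: "'w measure" and F :: "nat \<Rightarrow> 'w measure"
    and S :: "nat \<Rightarrow> 'w \<Rightarrow> 's :: finite" and P :: "'s \<Rightarrow> 's \<Rightarrow> real"
  assumes markov: "markov_state_process M F S P"

sublocale state_process \<subseteq> prob_space M
  using markov by (simp add: markov_state_process_def)

lemma (in prob_space) sigma_finite_subalgebraI:
  "subalgebra M G \<Longrightarrow> sigma_finite_subalgebra M G"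
  by (intro finite_measure_subalgebra_is_sigma_finite finite_measure_subalgebra.intro
      finite_measure_subalgebra_axioms.intro finite_measure_axioms)

lemma subalgebra_vimage_algebra:
  assumes "f \<in> M \<rightarrow>\<^sub>M K"
  shows "subalgebra M (vimage_algebra (space M) f K)"
  using assms
  by (auto simp: subalgebra_def sets_vimage_algebra2 measurable_space measurable_sets Pi_iff)

context state_process
begin

definition state_ind :: "nat \<Rightarrow> 's \<Rightarrow> 'w \<Rightarrow> real" where
  "state_ind t s = indicator {\<omega> \<in> space M. S t \<omega> = s}"

lemma state_ind_eq: "\<omega> \<in> space M \<Longrightarrow> state_ind t s \<omega> = (if S t \<omega> = s then 1 else 0)"
  by (simp add: state_ind_def)

lemma subalg_F: "subalgebra M (F t)"
  and state_measurable_F: "S t \<in> F t \<rightarrow>\<^sub>M count_space UNIV"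
  using markov by (auto simp: markov_state_process_def)

lemma space_F: "space (F t) = space M"
  using subalg_F[of t] by (simp add: subalgebra_def)

lemma subalg_F_mono: "t \<le> t' \<Longrightarrow> subalgebra (F t') (F t)"
  using markov filtration.sets_F_mono[of "space M" F t t'] 
  by (simp add: markov_state_process_def subalgebra_def space_F)

lemma state_measurable: "t \<le> t' \<Longrightarrow> S t \<in> F t' \<rightarrow>\<^sub>M count_space UNIV"
  by (rule measurable_from_subalg[OF subalg_F_mono state_measurable_F])

lemma state_measurable_M [measurable]: "S t \<in> M \<rightarrow>\<^sub>M count_space UNIV"
  by (rule measurable_from_subalg[OF subalg_F state_measurable_F])

lemma state_ind_measurable: "t \<le> t' \<Longrightarrow> state_ind t s \<in> borel_measurable (F t')"
proof -
  assume "t \<le> t'"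
  then have [measurable]: "S t \<in> F t' \<rightarrow>\<^sub>M count_space UNIV" by (rule state_measurable)
  have "{\<omega> \<in> space (F t'). S t \<omega> = s} \<in> sets (F t')" by measurable
  then show ?thesis by (auto simp: state_ind_def space_F intro!: borel_measurable_indicator)
qed

lemma state_ind_measurable_M [measurable]: "state_ind t s \<in> borel_measurable M"
  by (rule measurable_from_subalg[OF subalg_F state_ind_measurable[OF order_refl]])

lemma state_ind_integrable [simp]: "integrable M (state_ind t s)"
  by (rule integrable_const_bound[where B = 1]) (auto simp: state_ind_def indicator_def)

text \<open>The Markov property relative to the filtration, extended from one slot to \<open>k\<close> slots by the tower
  property.\<close>

lemma n_slot_transition:
  "AE \<omega> in M. real_cond_exp M (F t) (state_ind (t + k) s) \<omega> = n_step P k (S t \<omega>) s"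
proof (induction k arbitrary: t)
  case 0
  interpret sigma_finite_subalgebra M "F t" by (rule sigma_finite_subalgebraI[OF subalg_F])
  have "AE \<omega> in M. real_cond_exp M (F t) (state_ind t s) \<omega> = state_ind t s \<omega>"
    by (simp add: state_ind_measurable)
  then show ?case by (rule AE_mp) (simp add: state_ind_eq)
next
  case (Suc k)
  interpret sigma_finite_subalgebra M "F t" by (rule sigma_finite_subalgebraI[OF subalg_F])
  let ?E = "real_cond_exp M (F t)"
  let ?h = "\<lambda>\<omega>. \<Sum>u\<in>UNIV. n_step P k u s * state_ind (Suc t) u \<omega>"
  have int: "integrable M (\<lambda>\<omega>. n_step P k u s * state_ind (Suc t) u \<omega>)" for u by simp
  have tower: "AE \<omega> in M. ?E (real_cond_exp M (F (Suc t)) (state_ind (t + Suc k) s)) \<omega>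
      = ?E (state_ind (t + Suc k) s) \<omega>"
    by (intro real_cond_exp_nested_subalg subalg_F subalg_F_mono) auto
  have "AE \<omega> in M. real_cond_exp M (F (Suc t)) (state_ind (t + Suc k) s) \<omega> = ?h \<omega>"
    using Suc.IH[of "Suc t"]
    by (rule AE_mp) (auto intro!: AE_I2 simp: state_ind_eq if_distrib[of "(*) _"] cong: if_cong)
  then have cong: "AE \<omega> in M. ?E (real_cond_exp M (F (Suc t)) (state_ind (t + Suc k) s)) \<omega> = ?E ?h \<omega>"
    by (rule real_cond_exp_cong) auto
  have sum: "AE \<omega> in M. ?E ?h \<omega> = (\<Sum>u\<in>UNIV. ?E (\<lambda>\<omega>. n_step P k u s * state_ind (Suc t) u \<omega>) \<omega>)"
    by (rule real_cond_exp_sum[OF int])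
  have cmult: "AE \<omega> in M. \<forall>u\<in>UNIV. ?E (\<lambda>\<omega>. n_step P k u s * state_ind (Suc t) u \<omega>) \<omega>
      = n_step P k u s * ?E (state_ind (Suc t) u) \<omega>"
    by (rule AE_finite_allI) auto
  have step: "AE \<omega> in M. \<forall>u\<in>UNIV. ?E (state_ind (Suc t) u) \<omega> = P (S t \<omega>) u"
    using markov by (intro AE_finite_allI) (auto simp: markov_state_process_def state_ind_def)
  show ?case
    using tower cong sum cmult step
    by eventually_elim (simp add: mult.commute)
qed

definition occupation :: "nat \<Rightarrow> nat \<Rightarrow> 's \<Rightarrow> 'w \<Rightarrow> real" where
  "occupation t k s \<omega> = real (card (slots_in_state S s t k \<omega>))"

lemma occupation_eq:
  assumes "\<omega> \<in> space M"
  shows "occupation t k s \<omega> = (\<Sum>\<tau>\<in>{t..<t + k}. state_ind \<tau> s \<omega>)"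
proof -
  have "slots_in_state S s t k \<omega> = {\<tau> \<in> {t..<t + k}. S \<tau> \<omega> = s}"
    by (auto simp: slots_in_state_def)
  then show ?thesis
    using assms by (simp add: occupation_def state_ind_eq sum.If_cases Int_def)
qed

lemma occupation_measurable [measurable]: "occupation t k s \<in> borel_measurable M"
  by (subst measurable_cong[OF occupation_eq]) auto

lemma occupation_le: "occupation t k s \<omega> \<le> real k"
proof -
  have "card (slots_in_state S s t k \<omega>) \<le> card {t..<t + k}"
    by (rule card_mono) (auto simp: slots_in_state_def)
  then show ?thesis by (simp add: occupation_def)
qed

lemma occupation_nonneg: "0 \<le> occupation t k s \<omega>"
  by (simp add: occupation_def)

lemma occupation_integrable [simp]: "integrable M (occupation t k s)"
  by (rule integrable_const_bound[where B = "real k"]) (auto simp: occupation_nonneg occupation_le)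

lemma history_measurable:
  assumes "\<And>\<tau>. \<tau> < t \<Longrightarrow> S \<tau> \<in> G \<rightarrow>\<^sub>M count_space UNIV"
  shows "history S t \<in> G \<rightarrow>\<^sub>M count_space UNIV"
  using assms
proof (induction t)
  case 0
  then show ?case by (simp add: history_def[abs_def])
next
  case (Suc t)
  then have [measurable]: "history S t \<in> G \<rightarrow>\<^sub>M count_space UNIV" "S t \<in> G \<rightarrow>\<^sub>M count_space UNIV"
    by auto
  have "(\<lambda>\<omega>. history S t \<omega> @ [S t \<omega>]) \<in> G \<rightarrow>\<^sub>M count_space UNIV" by measurable
  then show ?case by (simp add: history_def[abs_def])
qed

text \<open>What determines the backlog at the start of slot \<open>t\<close>: the information after the action of slot
  \<open>t - 1\<close>, and nothing at slot \<open>0\<close>. It can be strictly richer than the history of the states, because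
  actions may be randomized. The trivial algebra at slot \<open>0\<close> is written as the one generated by the empty history,
  so that it is literally the one that occurs in \<open>convergent_length\<close>.\<close>

definition past :: "nat \<Rightarrow> 'w measure" where
  "past t = (case t of 0 \<Rightarrow> vimage_algebra (space M) (history S 0) (count_space UNIV) | Suc n \<Rightarrow> F n)"

lemma subalg_past: "subalgebra M (past t)"
  by (auto simp: past_def subalg_F subalgebra_vimage_algebra history_measurable split: nat.split)

text \<open>Convergent windows are defined by conditioning on the history of the states, whereas the drift argument
  must condition on everything that influences the backlog. Both give the same conditional expectation: by the Markov
  property the finer one is a function of the last state, hence measurable for the coarser algebra.\<close>

lemma occupation_given_past:
  "AE \<omega> in M. real_cond_exp M (past t) (occupation t k s) \<omega>
     = cond_expect_given M (count_space UNIV) (history S t) (occupation t k s) \<omega>"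
proof (cases t)
  case 0
  then show ?thesis by (simp add: past_def cond_expect_given_def)
next
  case (Suc n)
  let ?H = "vimage_algebra (space M) (history S t) (count_space UNIV)"
  define h where "h u = (\<Sum>\<tau>\<in>{t..<t + k}. n_step P (\<tau> - n) u s)" for u
  have "subalgebra (F n) (vimage_algebra (space (F n)) (history S t) (count_space UNIV))"
    by (rule subalgebra_vimage_algebra, rule history_measurable)
       (use Suc in \<open>auto intro: state_measurable\<close>)
  then have HF: "subalgebra (F n) ?H" by (simp add: space_F)
  have HM: "subalgebra M ?H"
    by (rule subalgebra_vimage_algebra, rule history_measurable) auto
  interpret G: sigma_finite_subalgebra M "F n" by (rule sigma_finite_subalgebraI[OF subalg_F])
  interpret H: sigma_finite_subalgebra M ?H by (rule sigma_finite_subalgebraI[OF HM])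
  have "AE \<omega> in M. real_cond_exp M (F n) (occupation t k s) \<omega>
      = real_cond_exp M (F n) (\<lambda>\<omega>. \<Sum>\<tau>\<in>{t..<t + k}. state_ind \<tau> s \<omega>) \<omega>"
    by (rule G.real_cond_exp_cong) (auto simp: occupation_eq)
  moreover have "AE \<omega> in M. real_cond_exp M (F n) (\<lambda>\<omega>. \<Sum>\<tau>\<in>{t..<t + k}. state_ind \<tau> s \<omega>) \<omega>
      = (\<Sum>\<tau>\<in>{t..<t + k}. real_cond_exp M (F n) (state_ind \<tau> s) \<omega>)"
    by (rule G.real_cond_exp_sum) simp
  moreover have "AE \<omega> in M. \<forall>\<tau>\<in>{t..<t + k}. real_cond_exp M (F n) (state_ind \<tau> s) \<omega>
      = n_step P (\<tau> - n) (S n \<omega>) s"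
  proof (rule AE_finite_allI)
    fix \<tau> assume "\<tau> \<in> {t..<t + k}"
    then have "n + (\<tau> - n) = \<tau>" using Suc by auto
    with n_slot_transition[of n "\<tau> - n" s]
    show "AE \<omega> in M. real_cond_exp M (F n) (state_ind \<tau> s) \<omega> = n_step P (\<tau> - n) (S n \<omega>) s" by simp
  qed simp
  ultimately have G: "AE \<omega> in M. real_cond_exp M (F n) (occupation t k s) \<omega> = h (S n \<omega>)"
    by eventually_elim (simp add: h_def)
  have "(\<lambda>\<omega>. h (last (history S t \<omega>))) \<in> borel_measurable ?H"
    by (rule measurable_compose[OF measurable_vimage_algebra1]) auto
  then have hH: "(\<lambda>\<omega>. h (S n \<omega>)) \<in> borel_measurable ?H"
    using Suc by (simp add: history_def)
  have hM [measurable]: "(\<lambda>\<omega>. h (S n \<omega>)) \<in> borel_measurable M"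
    by (rule measurable_from_subalg[OF HM hH])
  have int: "integrable M (\<lambda>\<omega>. h (S n \<omega>))"
    by (rule integrable_const_bound[where B = "\<Sum>u\<in>UNIV. \<bar>h u\<bar>"])
       (auto intro!: AE_I2 member_le_sum)
  have "AE \<omega> in M. real_cond_exp M ?H (real_cond_exp M (F n) (occupation t k s)) \<omega>
      = real_cond_exp M ?H (occupation t k s) \<omega>"
    by (intro H.real_cond_exp_nested_subalg subalg_F HF) simp
  moreover have "AE \<omega> in M. real_cond_exp M ?H (real_cond_exp M (F n) (occupation t k s)) \<omega>
      = real_cond_exp M ?H (\<lambda>\<omega>. h (S n \<omega>)) \<omega>"
    by (rule H.real_cond_exp_cong[OF G]) auto
  moreover have "AE \<omega> in M. real_cond_exp M ?H (\<lambda>\<omega>. h (S n \<omega>)) \<omega> = h (S n \<omega>)"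
    by (rule H.real_cond_exp_F_meas[OF int hH])
  ultimately have "AE \<omega> in M. real_cond_exp M ?H (occupation t k s) \<omega> = h (S n \<omega>)"
    by eventually_elim simp
  with G show ?thesis
    by eventually_elim (simp add: past_def cond_expect_given_def Suc)
qed

lemma occupation_near_stationary:
  assumes "convergent_length M S p \<nu> k"
  shows "AE \<omega> in M. (\<Sum>s\<in>UNIV. \<bar>p s - real_cond_exp M (past t) (occupation t k s) \<omega> / real k\<bar>) \<le> \<nu>"
proof -
  have "AE \<omega> in M. (\<Sum>s\<in>UNIV. \<bar>p s - cond_expect_given M (count_space UNIV) (history S t)
            (occupation t k s) \<omega> / real k\<bar>) \<le> \<nu>"
    using assms by (simp add: convergent_length_def occupation_def[abs_def])
  moreover have "AE \<omega> in M. \<forall>s\<in>UNIV. real_cond_exp M (past t) (occupation t k s) \<omega>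
     = cond_expect_given M (count_space UNIV) (history S t) (occupation t k s) \<omega>"
    by (rule AE_finite_allI) (auto intro: occupation_given_past)
  ultimately show ?thesis by eventually_elim simp
qed

end

section \<open>From drift to exponential moments\<close>

lemma exp_le_quadratic:
  fixes x :: real
  assumes "\<bar>x\<bar> \<le> 1"
  shows "exp x \<le> 1 + x + x\<^sup>2"
proof (cases "0 \<le> x")
  case True
  then show ?thesis using assms exp_bound[of x] by simp
next
  case False
  define y where "y = - x"
  have y: "0 < y" "y \<le> 1" using assms False by (auto simp: y_def)
  have "1 \<le> (1 - y + y\<^sup>2) * (1 + y)"
    using y by (simp add: power2_eq_square algebra_simps)
  also have "\<dots> \<le> (1 - y + y\<^sup>2) * exp y"
    using y exp_ge_add_one_self[of y] by (intro mult_left_mono) auto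
  finally have "exp (- y) \<le> 1 - y + y\<^sup>2" by (simp add: exp_minus divide_simps)
  then show ?thesis by (simp add: y_def)
qed

text \<open>Where \<open>Z \<ge> D\<close>, factor \<open>exp (w * Z') = exp (w * Z) * exp (w * (Z' - Z))\<close> and expand the second
  factor: the first-order term is at most \<open>- w * \<eta>\<close> on average, and the second-order term \<open>(w * K)\<^sup>2\<close> is at
  most half as large for small \<open>w\<close>. Where \<open>Z < D\<close>, \<open>Z'\<close> is below \<open>D + K\<close>. The drift is only
  used after multiplication by an \<open>H\<close>-measurable weight and integration, so no conditional exponential moment
  occurs.\<close>

lemma (in prob_space) exp_moment_drift:
  fixes Z Z' :: "'a \<Rightarrow> real"
  assumes H: "subalgebra M H"
    and Z: "Z \<in> borel_measurable H" and Z' [measurable]: "Z' \<in> borel_measurable M"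
    and bound: "\<And>\<omega>. \<omega> \<in> space M \<Longrightarrow> \<bar>Z \<omega>\<bar> \<le> C"
    and incr: "\<And>\<omega>. \<omega> \<in> space M \<Longrightarrow> \<bar>Z' \<omega> - Z \<omega>\<bar> \<le> K"
    and drift: "AE \<omega> in M. D \<le> Z \<omega> \<longrightarrow> real_cond_exp M H Z' \<omega> \<le> Z \<omega> - \<eta>"
    and w: "0 < w" "w * K \<le> 1" "w * K\<^sup>2 \<le> \<eta> / 2" "w * \<eta> \<le> 1"
  shows "(\<integral>\<omega>. exp (w * Z' \<omega>) \<partial>M) \<le> (1 - w * \<eta> / 2) * (\<integral>\<omega>. exp (w * Z \<omega>) \<partial>M) + exp (w * (D + K))"
proof -
  interpret H: sigma_finite_subalgebra M H by (rule sigma_finite_subalgebraI[OF H])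
  note Z [measurable]
  have ZM [measurable]: "Z \<in> borel_measurable M" by (rule measurable_from_subalg[OF H Z])
  define g where "g \<omega> = (if D \<le> Z \<omega> then exp (w * Z \<omega>) else 0)" for \<omega>
  have gH [measurable]: "g \<in> borel_measurable H" unfolding g_def by measurable
  have gM [measurable]: "g \<in> borel_measurable M" by (rule measurable_from_subalg[OF H gH])
  have Zle: "Z \<omega> \<le> C" if "\<omega> \<in> space M" for \<omega> using bound[OF that] by simp
  have Z'b: "\<bar>Z' \<omega>\<bar> \<le> C + K" if "\<omega> \<in> space M" for \<omega> using bound[OF that] incr[OF that] by linarith
  have g0: "0 \<le> g \<omega>" for \<omega> by (simp add: g_def)
  have gb: "g \<omega> \<le> exp (w * C)" if "\<omega> \<in> space M" for \<omega>
    using Zle[OF that] w by (auto simp: g_def)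
  have ig: "integrable M g"
    by (rule integrable_const_bound[where B = "exp (w * C)"]) (auto simp: g0 gb)
  have igZ: "integrable M (\<lambda>\<omega>. g \<omega> * Z \<omega>)"
    by (rule integrable_const_bound[where B = "exp (w * C) * C"])
       (auto simp: abs_mult g0 intro!: AE_I2 mult_mono gb bound)
  have igZ': "integrable M (\<lambda>\<omega>. g \<omega> * Z' \<omega>)"
    by (rule integrable_const_bound[where B = "exp (w * C) * (C + K)"])
       (auto simp: abs_mult g0 intro!: AE_I2 mult_mono gb Z'b)
  have iZ: "integrable M (\<lambda>\<omega>. exp (w * Z \<omega>))"
    by (rule integrable_const_bound[where B = "exp (w * C)"]) (use w Zle in auto)
  have iZ': "integrable M (\<lambda>\<omega>. exp (w * Z' \<omega>))"
  proof (rule integrable_const_bound[where B = "exp (w * (C + K))"])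
    show "AE \<omega> in M. norm (exp (w * Z' \<omega>)) \<le> exp (w * (C + K))"
      using w Z'b by (auto intro!: AE_I2 mult_left_mono simp: abs_le_iff)
  qed measurable
  have drift_int: "(\<integral>\<omega>. g \<omega> * Z' \<omega> \<partial>M) \<le> (\<integral>\<omega>. g \<omega> * Z \<omega> - \<eta> * g \<omega> \<partial>M)"
  proof -
    have "(\<integral>\<omega>. g \<omega> * Z' \<omega> \<partial>M) = (\<integral>\<omega>. g \<omega> * real_cond_exp M H Z' \<omega> \<partial>M)"
      by (rule H.real_cond_exp_intg(2)[symmetric]) (use igZ' in auto)
    also have "\<dots> \<le> (\<integral>\<omega>. g \<omega> * Z \<omega> - \<eta> * g \<omega> \<partial>M)"
    proof (rule integral_mono_AE)
      show "integrable M (\<lambda>\<omega>. g \<omega> * real_cond_exp M H Z' \<omega>)"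
        by (rule H.real_cond_exp_intg(1)) (use igZ' in auto)
      show "AE \<omega> in M. g \<omega> * real_cond_exp M H Z' \<omega> \<le> g \<omega> * Z \<omega> - \<eta> * g \<omega>"
        using drift
      proof eventually_elim
        case (elim \<omega>)
        have "g \<omega> * real_cond_exp M H Z' \<omega> \<le> g \<omega> * (Z \<omega> - \<eta>)"
          using elim by (auto simp: g_def)
        then show ?case by (simp add: algebra_simps)
      qed
    qed (use ig igZ in auto)
    finally show ?thesis .
  qed
  have pointwise: "exp (w * Z' \<omega>)
      \<le> g \<omega> * (1 + w\<^sup>2 * K\<^sup>2) + w * (g \<omega> * Z' \<omega> - g \<omega> * Z \<omega>) + exp (w * (D + K))"
    if \<omega>: "\<omega> \<in> space M" for \<omega>
  proof (cases "D \<le> Z \<omega>")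
    case True
    let ?x = "w * (Z' \<omega> - Z \<omega>)"
    have x: "\<bar>?x\<bar> \<le> w * K" using incr[OF \<omega>] w by (simp add: abs_mult)
    have "exp (w * Z' \<omega>) = exp (w * Z \<omega>) * exp ?x" by (simp add: exp_add[symmetric] algebra_simps)
    also have "\<dots> \<le> exp (w * Z \<omega>) * (1 + ?x + ?x\<^sup>2)"
      using x w by (intro mult_left_mono exp_le_quadratic) auto
    also have "\<dots> \<le> exp (w * Z \<omega>) * (1 + ?x + (w * K)\<^sup>2)"
      using power_mono[OF x, of 2] by (intro mult_left_mono) auto
    also have "\<dots> = g \<omega> * (1 + w\<^sup>2 * K\<^sup>2) + w * (g \<omega> * Z' \<omega> - g \<omega> * Z \<omega>)"
      using True by (simp add: g_def power_mult_distrib algebra_simps)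
    finally show ?thesis by (simp add: add_increasing2)
  next
    case False
    then have "Z' \<omega> \<le> D + K" using incr[OF \<omega>] by linarith
    then show ?thesis using w False by (simp add: g_def)
  qed
  have "(\<integral>\<omega>. exp (w * Z' \<omega>) \<partial>M)
      \<le> (\<integral>\<omega>. g \<omega> * (1 + w\<^sup>2 * K\<^sup>2) + w * (g \<omega> * Z' \<omega> - g \<omega> * Z \<omega>) + exp (w * (D + K)) \<partial>M)"
    by (rule integral_mono) (use iZ' ig igZ igZ' pointwise in auto)
  also have "\<dots> = (\<integral>\<omega>. g \<omega> \<partial>M) * (1 + w\<^sup>2 * K\<^sup>2)
      + w * ((\<integral>\<omega>. g \<omega> * Z' \<omega> \<partial>M) - (\<integral>\<omega>. g \<omega> * Z \<omega> \<partial>M)) + exp (w * (D + K))"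
    using ig igZ igZ' by (simp add: prob_space)
  also have "\<dots> \<le> (\<integral>\<omega>. g \<omega> \<partial>M) * (1 + w\<^sup>2 * K\<^sup>2)
      + w * (- \<eta> * (\<integral>\<omega>. g \<omega> \<partial>M)) + exp (w * (D + K))"
    using drift_int w ig igZ by (intro add_right_mono add_left_mono mult_left_mono) auto
  also have "\<dots> = (1 - w * \<eta> + w * (w * K\<^sup>2)) * (\<integral>\<omega>. g \<omega> \<partial>M) + exp (w * (D + K))"
    by (simp add: power2_eq_square algebra_simps)
  also have "\<dots> \<le> (1 - w * \<eta> / 2) * (\<integral>\<omega>. g \<omega> \<partial>M) + exp (w * (D + K))"
  proof -
    have "w * (w * K\<^sup>2) \<le> w * (\<eta> / 2)" using w by (intro mult_left_mono) auto
    then have "1 - w * \<eta> + w * (w * K\<^sup>2) \<le> 1 - w * \<eta> / 2" by (simp add: field_simps)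
    then show ?thesis
      by (intro add_mono mult_right_mono Bochner_Integration.integral_nonneg g0) auto
  qed
  also have "\<dots> \<le> (1 - w * \<eta> / 2) * (\<integral>\<omega>. exp (w * Z \<omega>) \<partial>M) + exp (w * (D + K))"
    using w by (intro add_mono mult_left_mono integral_mono ig iZ) (auto simp: g_def)
  finally show ?thesis .
qed

text \<open>Summing the recursion over a window of start times shows that, for \<open>\<rho> < 1\<close>, the long-run average of
  \<open>a\<close> is at most \<open>C / (1 - \<rho>)\<close>. Unlike iteration along multiples of \<open>k\<close>, this treats all residues
  modulo \<open>k\<close> at once.\<close>

lemma affine_recursion_sum:
  fixes a :: "nat \<Rightarrow> real"
  assumes "\<And>t. 0 \<le> a t" "\<And>t. a (t + k) \<le> \<rho> * a t + C"
  shows "(1 - \<rho>) * (\<Sum>\<tau><t. a \<tau>) \<le> (\<Sum>\<tau><k. a \<tau>) + real t * C"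
proof -
  have "(\<Sum>\<tau><t. a \<tau>) \<le> (\<Sum>\<tau><t + k. a \<tau>)"
    using assms(1) by (intro sum_mono2) auto
  also have "\<dots> = (\<Sum>\<tau><k. a \<tau>) + (\<Sum>\<tau><t. a (\<tau> + k))"
    by (induction t) auto
  also have "(\<Sum>\<tau><t. a (\<tau> + k)) \<le> (\<Sum>\<tau><t. \<rho> * a \<tau> + C)"
    by (intro sum_mono assms(2))
  also have "\<dots> = \<rho> * (\<Sum>\<tau><t. a \<tau>) + real t * C"
    by (simp add: sum.distrib sum_distrib_left)
  finally show ?thesis by (simp add: algebra_simps)
qed

section \<open>Drift and tail of the distance to the dual maximizer\<close>

locale qla_system =
  state_process M F S P + feasible_network N \<delta> B
  for M :: "'w measure" and F and S :: "nat \<Rightarrow> 'w \<Rightarrow> 's :: finite" and P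
    and N :: "('s, 'a :: topological_space, 'r :: finite) network" and \<delta> B
begin

lemma backlog_measurable_past:
  assumes run: "qla_run M F S N V x U"
  shows "U t \<in> borel_measurable (past t)"
proof (induction t)
  case 0
  have "(\<lambda>\<omega>. 0) \<in> borel_measurable (past 0)" by simp
  moreover have "U 0 \<omega> = 0" if "\<omega> \<in> space (past 0)" for \<omega>
    using run that subalg_past[of 0] by (simp add: qla_run_def subalgebra_def)
  ultimately show ?case by (simp cong: measurable_cong)
next
  case (Suc t)
  have space: "space (F t) = space M" by (rule space_F)
  have "subalgebra (F t) (past t)"
  proof (cases t)
    case 0
    have "subalgebra (F 0) (vimage_algebra (space (F 0)) (history S 0) (count_space UNIV))"
      by (rule subalgebra_vimage_algebra, rule history_measurable) auto
    then show ?thesis by (simp add: 0 past_def space_F)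
  qed (simp add: past_def subalg_F_mono)
  then have U: "U t \<in> borel_measurable (F t)" using Suc by (rule measurable_from_subalg)
  have A: "(\<lambda>\<omega>. arrival N (S t \<omega>) (x t \<omega>)) \<in> borel_measurable (F t)"
    and B: "(\<lambda>\<omega>. service N (S t \<omega>) (x t \<omega>)) \<in> borel_measurable (F t)"
    using run by (simp_all add: qla_run_def)
  have nth: "(\<lambda>\<omega>. f \<omega> $ j) \<in> borel_measurable (F t)" if "f \<in> borel_measurable (F t)"
    for f :: "'w \<Rightarrow> real ^ 'r" and j
    by (rule measurable_compose[OF that])
       (intro borel_measurable_continuous_onI continuous_intros)
  note [measurable] = nth[OF U] nth[OF A] nth[OF B]
  have "(\<lambda>\<omega>. U (Suc t) \<omega> $ j) \<in> borel_measurable (F t)" for j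
  proof -
    have "(\<lambda>\<omega>. max (U t \<omega> $ j - service N (S t \<omega>) (x t \<omega>) $ j) 0
        + arrival N (S t \<omega>) (x t \<omega>) $ j) \<in> borel_measurable (F t)" by measurable
    then show ?thesis
      by (subst measurable_cong[OF qla_step[OF run]]) (simp_all add: space)
  qed
  then have "U (Suc t) \<in> borel_measurable (F t)"
    unfolding borel_measurable_euclidean_space[of "U (Suc t)"]
    by (auto simp: Basis_vec_def inner_axis)
  then show ?case by (simp add: past_def)
qed

lemma backlog_measurable:
  assumes run: "qla_run M F S N V x U"
  shows "U t \<in> borel_measurable M"
  by (rule measurable_from_subalg[OF subalg_past backlog_measurable_past[OF run]])

lemma distance_bound:
  assumes run: "qla_run M F S N V x U" and \<omega>: "\<omega> \<in> space M"
  shows "norm (U t \<omega> - W) \<le> real t * B + norm W"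
  using qla_increment[OF run \<omega>, of 0 t] norm_triangle_ineq4[of "U t \<omega>" W] run \<omega>
  by (simp add: qla_run_def)

text \<open>The pathwise bound is averaged first given the whole past, where the visit counts are known to be
  nearly stationary and the backlog is a constant, and then given the backlog alone, which is a function of
  the past. The condition on the distance says precisely that the resulting bound on its conditional
  mean square is at most \<open>(norm (U t \<omega> - W) - \<eta>)\<^sup>2\<close>.\<close>

lemma qla_drift:
  assumes run: "qla_run M F S N V x U"
    and conv: "convergent_length M S p \<nu> k"
    and p: "\<And>s. 0 \<le> p s"
    and W: "0 \<le> W"
    and poly: "\<And>U. 0 \<le> U \<Longrightarrow> dual N p V U - dual N p V W \<le> - L * norm (U - W)"
    and \<eta>: "0 \<le> \<eta>"
  shows "AE \<omega> in M. \<eta> \<le> norm (U t \<omega> - W) \<and>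
      (real k)\<^sup>2 * B\<^sup>2 - \<eta>\<^sup>2 \<le> 2 * (real k * (L - B * \<nu>) - \<eta>) * norm (U t \<omega> - W) \<longrightarrow>
      cond_expect_given M borel (U t) (\<lambda>\<omega>. norm (U (t + k) \<omega> - W)) \<omega> \<le> norm (U t \<omega> - W) - \<eta>"
proof -
  define Y where "Y \<tau> \<omega> = norm (U \<tau> \<omega> - W)" for \<tau> \<omega>
  define d where "d s \<omega> = state_dual N V s (U t \<omega>) - state_dual N V s W" for s \<omega>
  define G where "G = past t"
  define H where "H = vimage_algebra (space M) (U t) (borel :: (real ^ 'r) measure)"
  have k: "0 < k" using conv by (simp add: convergent_length_def)
  have subG: "subalgebra M G" unfolding G_def by (rule subalg_past)
  have spG: "space G = space M" using subG by (simp add: subalgebra_def)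
  have UG [measurable]: "U t \<in> borel_measurable G"
    unfolding G_def by (rule backlog_measurable_past[OF run])
  have UM [measurable]: "U \<tau> \<in> borel_measurable M" for \<tau>
    by (rule backlog_measurable[OF run])
  have subH: "subalgebra M H" unfolding H_def by (rule subalgebra_vimage_algebra) simp
  have subGH: "subalgebra G H"
    using subalgebra_vimage_algebra[OF UG] by (simp add: H_def spG)
  have UH [measurable]: "U t \<in> borel_measurable H"
    unfolding H_def by (rule measurable_vimage_algebra1) simp
  interpret G: sigma_finite_subalgebra M G by (rule sigma_finite_subalgebraI[OF subG])
  interpret H: sigma_finite_subalgebra M H by (rule sigma_finite_subalgebraI[OF subH])
  have dG [measurable]: "d s \<in> borel_measurable G" for s
    unfolding d_def
    by (intro borel_measurable_diff borel_measurable_const measurable_compose[OF UG]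
        borel_measurable_continuous_onI state_dual_continuous)
  have dM [measurable]: "d s \<in> borel_measurable M" for s
    by (rule measurable_from_subalg[OF subG dG])
  have YM [measurable]: "Y \<tau> \<in> borel_measurable M" for \<tau> unfolding Y_def by measurable
  have YH [measurable]: "Y t \<in> borel_measurable H" unfolding Y_def by measurable
  have YG [measurable]: "Y t \<in> borel_measurable G" unfolding Y_def by measurable
  define C where "C \<tau> = real \<tau> * B + norm W" for \<tau>
  have Y0: "0 \<le> Y \<tau> \<omega>" for \<tau> \<omega> by (simp add: Y_def)
  have YC: "Y \<tau> \<omega> \<le> C \<tau>" if "\<omega> \<in> space M" for \<tau> \<omega>
    using distance_bound[OF run that] by (simp add: Y_def C_def)
  have C0: "0 \<le> C \<tau>" for \<tau> using B_pos by (simp add: C_def)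
  have dY: "\<bar>d s \<omega>\<bar> \<le> B * Y t \<omega>" for s \<omega>
    using state_dual_Lipschitz by (simp add: d_def Y_def)
  have dC: "\<bar>d s \<omega>\<bar> \<le> B * C t" if "\<omega> \<in> space M" for s \<omega>
    using B_pos by (intro order_trans[OF dY] mult_left_mono YC[OF that]) auto
  have iY: "integrable M (Y \<tau>)" for \<tau>
    by (rule integrable_const_bound[where B = "C \<tau>"]) (auto simp: Y0 YC)
  have iY2: "integrable M (\<lambda>\<omega>. (Y \<tau> \<omega>)\<^sup>2)" for \<tau>
    by (rule integrable_const_bound[where B = "(C \<tau>)\<^sup>2"]) (auto simp: Y0 YC power_mono)
  have iD: "integrable M (\<lambda>\<omega>. d s \<omega> * occupation t k s \<omega>)" for s
    by (rule integrable_const_bound[where B = "B * C t * real k"])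
       (auto simp: abs_mult occupation_nonneg intro!: AE_I2 mult_mono dC occupation_le C0 mult_nonneg_nonneg
         less_imp_le[OF B_pos])
  let ?R = "\<lambda>\<omega>. ((Y t \<omega>)\<^sup>2 + (real k)\<^sup>2 * B\<^sup>2) + 2 * (\<Sum>s\<in>UNIV. d s \<omega> * occupation t k s \<omega>)"
  have path: "(Y (t + k) \<omega>)\<^sup>2 \<le> ?R \<omega>" if \<omega>: "\<omega> \<in> space M" for \<omega>
  proof -
    have "(\<Sum>\<tau>\<in>{t..<t + k}. d (S \<tau> \<omega>) \<omega>)
        = (\<Sum>\<tau>\<in>{t..<t + k}. \<Sum>s\<in>UNIV. d s \<omega> * state_ind \<tau> s \<omega>)"
      using \<omega> by (intro sum.cong refl) (simp add: state_ind_eq if_distrib[of "(*) _"] cong: if_cong)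
    also have "\<dots> = (\<Sum>s\<in>UNIV. d s \<omega> * occupation t k s \<omega>)"
      by (subst sum.swap) (simp add: occupation_eq[OF \<omega>] sum_distrib_left)
    finally show ?thesis
      using qla_many_slots[OF run \<omega> W, of t k] by (simp add: Y_def d_def)
  qed
  let ?E = "\<lambda>s. real_cond_exp M G (occupation t k s)"
  have "AE \<omega> in M. real_cond_exp M G (\<lambda>\<omega>. (Y (t + k) \<omega>)\<^sup>2) \<omega> \<le> real_cond_exp M G ?R \<omega>"
    by (rule G.real_cond_exp_mono) (use path iY2 iD in auto)
  moreover have "AE \<omega> in M. real_cond_exp M G ?R \<omega>
      = real_cond_exp M G (\<lambda>\<omega>. (Y t \<omega>)\<^sup>2 + (real k)\<^sup>2 * B\<^sup>2) \<omega>
        + real_cond_exp M G (\<lambda>\<omega>. 2 * (\<Sum>s\<in>UNIV. d s \<omega> * occupation t k s \<omega>)) \<omega>"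
    by (rule G.real_cond_exp_add) (use iY2 iD in auto)
  moreover have "AE \<omega> in M. real_cond_exp M G (\<lambda>\<omega>. (Y t \<omega>)\<^sup>2 + (real k)\<^sup>2 * B\<^sup>2) \<omega>
      = (Y t \<omega>)\<^sup>2 + (real k)\<^sup>2 * B\<^sup>2"
    by (rule G.real_cond_exp_F_meas) (use iY2 in auto)
  moreover have "AE \<omega> in M. real_cond_exp M G (\<lambda>\<omega>. 2 * (\<Sum>s\<in>UNIV. d s \<omega> * occupation t k s \<omega>)) \<omega>
      = 2 * real_cond_exp M G (\<lambda>\<omega>. \<Sum>s\<in>UNIV. d s \<omega> * occupation t k s \<omega>) \<omega>"
    by (rule G.real_cond_exp_cmult) (use iD in auto)
  moreover have "AE \<omega> in M. real_cond_exp M G (\<lambda>\<omega>. \<Sum>s\<in>UNIV. d s \<omega> * occupation t k s \<omega>) \<omega>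
      = (\<Sum>s\<in>UNIV. real_cond_exp M G (\<lambda>\<omega>. d s \<omega> * occupation t k s \<omega>) \<omega>)"
    by (rule G.real_cond_exp_sum[OF iD])
  moreover have "AE \<omega> in M. \<forall>s\<in>UNIV. real_cond_exp M G (\<lambda>\<omega>. d s \<omega> * occupation t k s \<omega>) \<omega>
      = d s \<omega> * ?E s \<omega>"
    by (intro AE_finite_allI G.real_cond_exp_mult dG iD occupation_measurable) auto
  moreover have "AE \<omega> in M. (\<Sum>s\<in>UNIV. \<bar>p s - ?E s \<omega> / real k\<bar>) \<le> \<nu>"
    unfolding G_def by (rule occupation_near_stationary[OF conv])
  ultimately have sq_past: "AE \<omega> in M. real_cond_exp M G (\<lambda>\<omega>. (Y (t + k) \<omega>)\<^sup>2) \<omega>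
      \<le> (Y t \<omega>)\<^sup>2 + (real k)\<^sup>2 * B\<^sup>2 - 2 * real k * (L - B * \<nu>) * Y t \<omega>"
    using AE_space
  proof eventually_elim
    case (elim \<omega>)
    \<comment> \<open>split the visit counts into their stationary part, which gives the dual function, and the
      deviation from it, which \<open>\<nu>\<close> controls\<close>
    have "(\<Sum>s\<in>UNIV. d s \<omega> * ?E s \<omega>)
        = real k * ((\<Sum>s\<in>UNIV. p s * d s \<omega>) + (\<Sum>s\<in>UNIV. d s \<omega> * (?E s \<omega> / real k - p s)))"
      using k by (simp add: sum_distrib_left flip: sum.distrib) (simp add: field_simps)
    also have "(\<Sum>s\<in>UNIV. p s * d s \<omega>) = dual N p V (U t \<omega>) - dual N p V W"
      by (simp add: d_def dual_eq_sum_state_dual[OF p] right_diff_distrib sum_subtractf)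
    also have "\<dots> \<le> - L * Y t \<omega>"
      using poly[OF qla_backlog_nonneg[OF run elim(8)], of t] by (simp add: Y_def)
    also have "(\<Sum>s\<in>UNIV. d s \<omega> * (?E s \<omega> / real k - p s))
        \<le> (\<Sum>s\<in>UNIV. (B * Y t \<omega>) * \<bar>p s - ?E s \<omega> / real k\<bar>)"
    proof (rule sum_mono)
      fix s
      have "d s \<omega> * (?E s \<omega> / real k - p s) \<le> \<bar>d s \<omega>\<bar> * \<bar>?E s \<omega> / real k - p s\<bar>"
        by (metis abs_ge_self abs_mult)
      also have "\<dots> \<le> (B * Y t \<omega>) * \<bar>p s - ?E s \<omega> / real k\<bar>"
        by (subst abs_minus_commute) (intro mult_right_mono dY abs_ge_zero)
      finally show "d s \<omega> * (?E s \<omega> / real k - p s) \<le> (B * Y t \<omega>) * \<bar>p s - ?E s \<omega> / real k\<bar>" .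
    qed
    also have "\<dots> = (B * Y t \<omega>) * (\<Sum>s\<in>UNIV. \<bar>p s - ?E s \<omega> / real k\<bar>)"
      by (simp add: sum_distrib_left)
    also have "\<dots> \<le> (B * Y t \<omega>) * \<nu>"
      using elim(7) B_pos Y0 by (intro mult_left_mono) auto
    finally have "(\<Sum>s\<in>UNIV. d s \<omega> * ?E s \<omega>) \<le> real k * (- L * Y t \<omega> + B * Y t \<omega> * \<nu>)"
      by (simp add: mult_left_mono)
    then show ?case using elim(1-6) by (simp add: algebra_simps)
  qed
  let ?Q = "\<lambda>\<omega>. (Y t \<omega>)\<^sup>2 + (real k)\<^sup>2 * B\<^sup>2 - 2 * real k * (L - B * \<nu>) * Y t \<omega>"
  have iQ: "integrable M ?Q" using iY2 iY by auto
  have "AE \<omega> in M. real_cond_exp M H (real_cond_exp M G (\<lambda>\<omega>. (Y (t + k) \<omega>)\<^sup>2)) \<omega>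
      = real_cond_exp M H (\<lambda>\<omega>. (Y (t + k) \<omega>)\<^sup>2) \<omega>"
    by (rule H.real_cond_exp_nested_subalg[OF subG subGH iY2])
  moreover have "AE \<omega> in M. real_cond_exp M H (real_cond_exp M G (\<lambda>\<omega>. (Y (t + k) \<omega>)\<^sup>2)) \<omega>
      \<le> real_cond_exp M H ?Q \<omega>"
    by (rule H.real_cond_exp_mono[OF sq_past]) (use iQ iY2 G.real_cond_exp_int(1) in auto)
  moreover have "AE \<omega> in M. real_cond_exp M H ?Q \<omega> = ?Q \<omega>"
    by (rule H.real_cond_exp_F_meas[OF iQ]) measurable
  moreover have "AE \<omega> in M. (real_cond_exp M H (Y (t + k)) \<omega>)\<^sup>2
      \<le> real_cond_exp M H (\<lambda>\<omega>. (Y (t + k) \<omega>)\<^sup>2) \<omega>"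
    by (rule H.real_cond_exp_jensens_inequality(2)[where I = UNIV])
       (use iY iY2 convex_power2 in auto)
  ultimately have "AE \<omega> in M. (real_cond_exp M H (Y (t + k)) \<omega>)\<^sup>2 \<le> ?Q \<omega>"
    by eventually_elim simp
  then have "AE \<omega> in M. \<eta> \<le> Y t \<omega> \<and>
      (real k)\<^sup>2 * B\<^sup>2 - \<eta>\<^sup>2 \<le> 2 * (real k * (L - B * \<nu>) - \<eta>) * Y t \<omega> \<longrightarrow>
      real_cond_exp M H (Y (t + k)) \<omega> \<le> Y t \<omega> - \<eta>"
  proof eventually_elim
    case (elim \<omega>)
    show ?case
    proof (intro impI, elim conjE)
      assume 1: "\<eta> \<le> Y t \<omega>"
        and 2: "(real k)\<^sup>2 * B\<^sup>2 - \<eta>\<^sup>2 \<le> 2 * (real k * (L - B * \<nu>) - \<eta>) * Y t \<omega>"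
      have "(Y t \<omega> - \<eta>)\<^sup>2 = (Y t \<omega>)\<^sup>2 - 2 * \<eta> * Y t \<omega> + \<eta>\<^sup>2"
        by (simp add: power2_diff)
      then have "(real_cond_exp M H (Y (t + k)) \<omega>)\<^sup>2 \<le> (Y t \<omega> - \<eta>)\<^sup>2"
        using elim 2 by (simp add: algebra_simps)
      then show "real_cond_exp M H (Y (t + k)) \<omega> \<le> Y t \<omega> - \<eta>"
        using 1 by (auto intro: power2_le_imp_le)
    qed
  qed
  then show ?thesis by (simp add: cond_expect_given_def H_def Y_def[abs_def])
qed

text \<open>The exponential moments \<open>a t\<close> satisfy an affine recursion with window \<open>k\<close>, whose
  coefficients do not involve the initial distance; the latter enters only through
  \<open>\<Sum>\<tau><k. a \<tau>\<close>, which vanishes after division by \<open>t\<close>. The factor \<open>exp (w * D)\<close> of the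
  recursion cancels against the one of the Markov inequality.\<close>

lemma deviation_freq_bound:
  assumes run: "qla_run M F S N V x U"
    and k: "0 < k"
    and drift: "\<And>t. AE \<omega> in M. D \<le> norm (U t \<omega> - W) \<longrightarrow>
      cond_expect_given M borel (U t) (\<lambda>\<omega>. norm (U (t + k) \<omega> - W)) \<omega> \<le> norm (U t \<omega> - W) - \<eta>"
    and w: "0 < w" "w * (real k * B) \<le> 1" "w * (real k * B)\<^sup>2 \<le> \<eta> / 2" "w * \<eta> \<le> 1" and \<eta>: "0 < \<eta>"
  shows "deviation_freq M U W D m \<le> ereal (2 * exp (w * (real k * B)) / (w * \<eta>) * exp (- w * m))"
proof -
  define a where "a t = (\<integral>\<omega>. exp (w * norm (U t \<omega> - W)) \<partial>M)" for t
  define C where "C = exp (w * (D + real k * B))"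
  note UM [measurable] = backlog_measurable[OF run]
  have int: "integrable M (\<lambda>\<omega>. exp (w * norm (U t \<omega> - W)))" for t
    by (rule integrable_const_bound[where B = "exp (w * (real t * B + norm W))"])
       (use w distance_bound[OF run] in auto)
  have a0: "0 \<le> a t" for t by (simp add: a_def)
  have step: "a (t + k) \<le> (1 - w * \<eta> / 2) * a t + C" for t
    unfolding a_def C_def
  proof (rule exp_moment_drift[where H = "vimage_algebra (space M) (U t) borel"
        and C = "real t * B + norm W", OF _ _ _ _ _ _ w])
    show "subalgebra M (vimage_algebra (space M) (U t) borel)"
      by (rule subalgebra_vimage_algebra) simp
    have [measurable]: "U t \<in> borel_measurable (vimage_algebra (space M) (U t) borel)"
      by (rule measurable_vimage_algebra1) simp
    show "(\<lambda>\<omega>. norm (U t \<omega> - W)) \<in> borel_measurable (vimage_algebra (space M) (U t) borel)"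
      by measurable
    show "AE \<omega> in M. D \<le> norm (U t \<omega> - W) \<longrightarrow>
        real_cond_exp M (vimage_algebra (space M) (U t) borel) (\<lambda>\<omega>. norm (U (t + k) \<omega> - W)) \<omega>
          \<le> norm (U t \<omega> - W) - \<eta>"
      using drift[of t] by (simp add: cond_expect_given_def)
    fix \<omega> assume \<omega>: "\<omega> \<in> space M"
    show "\<bar>norm (U t \<omega> - W)\<bar> \<le> real t * B + norm W"
      using distance_bound[OF run \<omega>] by simp
    show "\<bar>norm (U (t + k) \<omega> - W) - norm (U t \<omega> - W)\<bar> \<le> real k * B"
      using qla_increment[OF run \<omega>, of t k] norm_triangle_ineq3[of "U (t + k) \<omega> - W" "U t \<omega> - W"]
      by simp
  qed measurable
  have prob: "measure M {\<omega> \<in> space M. norm (U t \<omega> - W) > D + m} \<le> exp (- w * (D + m)) * a t" for t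
  proof -
    have "measure M {\<omega> \<in> space M. norm (U t \<omega> - W) > D + m}
        = (\<integral>\<omega>. indicator {\<omega> \<in> space M. norm (U t \<omega> - W) > D + m} \<omega> \<partial>M)"
      by simp
    also have "\<dots> \<le> (\<integral>\<omega>. exp (- w * (D + m)) * exp (w * norm (U t \<omega> - W)) \<partial>M)"
    proof (rule integral_mono)
      fix \<omega>
      show "indicator {\<omega> \<in> space M. norm (U t \<omega> - W) > D + m} \<omega>
          \<le> exp (- w * (D + m)) * exp (w * norm (U t \<omega> - W))"
        using w by (auto simp: indicator_def exp_add[symmetric] mult_left_mono)
    qed (use int in \<open>auto simp: finite_measure_axioms emeasure_eq_measure\<close>)
    also have "\<dots> = exp (- w * (D + m)) * a t" by (simp add: a_def)
    finally show ?thesis .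
  qed
  define b where "b t = 2 * exp (- w * (D + m)) / (w * \<eta>) * ((\<Sum>\<tau><k. a \<tau>) * (1 / real t) + C)" for t
  have le_b: "1 / real t * (\<Sum>\<tau><t. measure M {\<omega> \<in> space M. norm (U \<tau> \<omega> - W) > D + m}) \<le> b t"
    if t: "0 < t" for t
  proof -
    have "(w * \<eta> / 2) * (\<Sum>\<tau><t. a \<tau>) \<le> (\<Sum>\<tau><k. a \<tau>) + real t * C"
      using affine_recursion_sum[where a = a, OF a0 step, of t] by simp
    then have *: "(\<Sum>\<tau><t. a \<tau>) \<le> 2 / (w * \<eta>) * ((\<Sum>\<tau><k. a \<tau>) + real t * C)"
      using w \<eta> by (simp add: field_simps)
    have "(\<Sum>\<tau><t. measure M {\<omega> \<in> space M. norm (U \<tau> \<omega> - W) > D + m})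
        \<le> exp (- w * (D + m)) * (\<Sum>\<tau><t. a \<tau>)"
      unfolding sum_distrib_left by (intro sum_mono prob)
    also have "\<dots> \<le> exp (- w * (D + m)) * (2 / (w * \<eta>) * ((\<Sum>\<tau><k. a \<tau>) + real t * C))"
      by (intro mult_left_mono *) simp
    also have "\<dots> = real t * b t"
      using t w \<eta> by (simp add: b_def field_simps)
    finally show ?thesis using t by (simp add: field_simps)
  qed
  have "(\<lambda>t. 1 / real t) \<longlonglongrightarrow> 0" by (rule lim_1_over_n)
  then have "b \<longlonglongrightarrow> 2 * exp (- w * (D + m)) / (w * \<eta>) * ((\<Sum>\<tau><k. a \<tau>) * 0 + C)"
    unfolding b_def by (intro tendsto_intros)
  also have "2 * exp (- w * (D + m)) / (w * \<eta>) * ((\<Sum>\<tau><k. a \<tau>) * 0 + C)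
      = 2 * exp (w * (real k * B)) / (w * \<eta>) * exp (- w * m)"
    by (simp add: C_def exp_add[symmetric] algebra_simps)
  finally have lim: "(\<lambda>t. ereal (b t)) \<longlonglongrightarrow> ereal (2 * exp (w * (real k * B)) / (w * \<eta>) * exp (- w * m))"
    by simp
  have "deviation_freq M U W D m \<le> limsup (\<lambda>t. ereal (b t))"
    unfolding deviation_freq_def
    by (intro Limsup_mono eventually_mono[OF eventually_gt_at_top[of 0]]) (use le_b in simp)
  also have "\<dots> = ereal (2 * exp (w * (real k * B)) / (w * \<eta>) * exp (- w * m))"
    using lim by (intro lim_imp_Limsup) auto
  finally show ?thesis .
qed

end

theorem theorem1:
  fixes M :: "'w measure" and F :: "nat \<Rightarrow> 'w measure"
    and S :: "nat \<Rightarrow> 'w \<Rightarrow> 's :: finite"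
    and P :: "'s \<Rightarrow> 's \<Rightarrow> real" and p :: "'s \<Rightarrow> real"
    and N :: "('s, 'a :: topological_space, 'r :: finite) network"
    and \<delta> \<epsilon> L B :: real
  assumes "ergodic_kernel P p"
    and "markov_state_process M F S P"
    and "bounded_network N \<delta>"
    and "slackness N p"
    and "\<forall>V\<ge>1. unique_dual_maximizer N p V"
    and "\<forall>\<nu>>0. \<exists>k. convergent_length M S p \<nu> k"
    and B: "B = sqrt (real CARD('r)) * \<delta>"
    and "\<epsilon> > 0" and "L > 0"
    and "locally_polyhedral (dual N p 1) (U_star N p 1) \<epsilon> L"
  shows
    "(\<exists>\<nu> D \<eta>. \<nu> > 0 \<and> 0 < \<eta> \<and> \<eta> \<le> D \<and> drift_condition M F S p N \<nu> D \<eta>)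
     \<and> (\<forall>\<nu> \<eta> D. 0 < \<nu> \<and> \<nu> < L / B \<and>
          0 < \<eta> \<and> \<eta> < real (T_nu M S p \<nu>) * (L - B * \<nu>) \<and>
          D = max ((((real (T_nu M S p \<nu>))\<^sup>2 + real (T_nu M S p \<nu>)) * B\<^sup>2 - \<eta>\<^sup>2) /
                   (2 * real (T_nu M S p \<nu>) * (L - \<eta> / real (T_nu M S p \<nu>) - B * \<nu>))) \<eta>
          \<longrightarrow> drift_condition M F S p N \<nu> D \<eta>)
     \<and> (\<forall>\<nu> D \<eta>. \<nu> > 0 \<and> 0 < \<eta> \<and> \<eta> \<le> D \<and> drift_condition M F S p N \<nu> D \<eta> \<longrightarrow>
          (\<exists>c \<beta>. c > 0 \<and> \<beta> > 0 \<and>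
             (\<forall>V\<ge>1. \<forall>x U. qla_run M F S N V x U \<longrightarrow>
                (\<forall>m\<ge>0. deviation_freq M U (U_star N p V) D m \<le> ereal (c * exp (- \<beta> * m))))))"
    (is "?ex \<and> ?explicit \<and> ?tail")
proof -
  have ne: "feasible N s \<noteq> {}" for s
  proof -
    obtain y :: "'s \<Rightarrow> nat \<Rightarrow> 'a"
      where "\<forall>s. \<forall>k\<in>{1..CARD('r) + 2}. y s k \<in> feasible N s"
      using assms(4) unfolding slackness_def by blast
    then have "y s 1 \<in> feasible N s" by auto
    then show ?thesis by blast
  qed
  interpret qla_system M F S P N \<delta> B
    by unfold_locales (fact assms ne)+
  have p: "0 \<le> p s" for s using assms(1) unfolding ergodic_kernel_def by blast
  have unique: "unique_dual_maximizer N p V" if "1 \<le> V" for V using assms(5) that by blast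
  have T: "convergent_length M S p \<nu> (T_nu M S p \<nu>)" if "0 < \<nu>" for \<nu>
    unfolding T_nu_def using assms(6) that by (metis LeastI_ex)
  have T_pos: "0 < T_nu M S p \<nu>" if "0 < \<nu>" for \<nu>
    using T[OF that] by (simp add: convergent_length_def)
  have explicit: ?explicit
  proof (intro allI impI, elim conjE)
    fix \<nu> \<eta> D
    let ?T = "real (T_nu M S p \<nu>)"
    assume \<nu>: "0 < \<nu>" and \<eta>: "0 < \<eta>" "\<eta> < ?T * (L - B * \<nu>)"
      and D: "D = max (((?T\<^sup>2 + ?T) * B\<^sup>2 - \<eta>\<^sup>2) / (2 * ?T * (L - \<eta> / ?T - B * \<nu>))) \<eta>"
    show "drift_condition M F S p N \<nu> D \<eta>"
      unfolding drift_condition_def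
    proof (intro allI impI)
      fix V x U t
      assume V: "1 \<le> V" and run: "qla_run M F S N V x U"
      let ?W = "U_star N p V" and ?k = "T_nu M S p \<nu>"
      have W: "0 \<le> ?W" using U_star_is_arg_max[OF unique[OF V]] by (simp add: is_arg_max_def)
      have poly: "dual N p V U - dual N p V ?W \<le> - L * norm (U - ?W)" if "0 \<le> U" for U
        by (rule dual_polyhedral[OF p V unique assms(8) assms(10) that])
      \<comment> \<open>\<open>D\<close> solves this inequality with the larger \<open>(T\<^sup>2 + T) * B\<^sup>2\<close> in place of \<open>T\<^sup>2 * B\<^sup>2\<close>\<close>
      have suff: "(real ?k)\<^sup>2 * B\<^sup>2 - \<eta>\<^sup>2 \<le> 2 * (real ?k * (L - B * \<nu>) - \<eta>) * y" if "D \<le> y" for y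
      proof -
        have den: "2 * ?T * (L - \<eta> / ?T - B * \<nu>) = 2 * (?T * (L - B * \<nu>) - \<eta>)"
          using T_pos[OF \<nu>] by (simp add: field_simps)
        have "((?T\<^sup>2 + ?T) * B\<^sup>2 - \<eta>\<^sup>2) / (2 * (?T * (L - B * \<nu>) - \<eta>)) \<le> y"
          using that D unfolding den by simp
        then have "(?T\<^sup>2 + ?T) * B\<^sup>2 - \<eta>\<^sup>2 \<le> y * (2 * (?T * (L - B * \<nu>) - \<eta>))"
          using \<eta> by (subst (asm) pos_divide_le_eq) auto
        moreover have "?T\<^sup>2 * B\<^sup>2 \<le> (?T\<^sup>2 + ?T) * B\<^sup>2" by (simp add: distrib_right)
        ultimately show ?thesis by (simp add: mult.commute)
      qed
      have "\<eta> \<le> D" using D by simp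
      show "AE \<omega> in M. norm (U t \<omega> - ?W) \<ge> D \<longrightarrow>
          cond_expect_given M borel (U t) (\<lambda>\<omega>'. norm (U (t + ?k) \<omega>' - ?W)) \<omega>
            \<le> norm (U t \<omega> - ?W) - \<eta>"
      proof (rule AE_mp)
        show "AE \<omega> in M. \<eta> \<le> norm (U t \<omega> - ?W) \<and>
            (real ?k)\<^sup>2 * B\<^sup>2 - \<eta>\<^sup>2
              \<le> 2 * (real ?k * (L - B * \<nu>) - \<eta>) * norm (U t \<omega> - ?W) \<longrightarrow>
            cond_expect_given M borel (U t) (\<lambda>\<omega>. norm (U (t + ?k) \<omega> - ?W)) \<omega>
              \<le> norm (U t \<omega> - ?W) - \<eta>"
          by (rule qla_drift[OF run T[OF \<nu>] p W]) (use poly \<eta> in auto)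
      qed (use suff \<open>\<eta> \<le> D\<close> in \<open>auto intro!: AE_I2\<close>)
    qed
  qed
  have ex: ?ex
  proof -
    define \<nu> where "\<nu> = L / (2 * B)"
    define \<eta> where "\<eta> = real (T_nu M S p \<nu>) * L / 4"
    have \<nu>: "0 < \<nu>" "\<nu> < L / B" "B * \<nu> = L / 2"
      using B_pos assms(9) by (simp_all add: \<nu>_def field_simps)
    have \<eta>: "0 < \<eta>" "\<eta> < real (T_nu M S p \<nu>) * (L - B * \<nu>)"
      using T_pos[OF \<nu>(1)] assms(9) by (simp_all add: \<eta>_def \<nu>(3))
    define D where "D = max ((((real (T_nu M S p \<nu>))\<^sup>2 + real (T_nu M S p \<nu>)) * B\<^sup>2 - \<eta>\<^sup>2) /
        (2 * real (T_nu M S p \<nu>) * (L - \<eta> / real (T_nu M S p \<nu>) - B * \<nu>))) \<eta>"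
    have "\<eta> \<le> D" by (simp add: D_def)
    moreover have "drift_condition M F S p N \<nu> D \<eta>"
      using explicit \<nu> \<eta> D_def by blast
    ultimately show ?thesis using \<nu> \<eta> by blast
  qed
  have tail: ?tail
  proof (intro allI impI, elim conjE)
    fix \<nu> D \<eta>
    assume \<nu>: "0 < \<nu>" and \<eta>: "0 < \<eta>" and drift: "drift_condition M F S p N \<nu> D \<eta>"
    let ?k = "T_nu M S p \<nu>"
    define K where "K = real ?k * B"
    have K: "0 < K" using T_pos[OF \<nu>] B_pos by (simp add: K_def)
    \<comment> \<open>the three bounds on the exponent that \<open>exp_moment_drift\<close> asks for\<close>
    define w where "w = min (1 / K) (min (\<eta> / (2 * K\<^sup>2)) (1 / \<eta>))"
    have w: "0 < w" using K \<eta> by (simp add: w_def)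
    have "w * K \<le> 1 / K * K" using K by (intro mult_right_mono) (auto simp: w_def)
    then have w1: "w * K \<le> 1" using K by simp
    have "w * K\<^sup>2 \<le> \<eta> / (2 * K\<^sup>2) * K\<^sup>2" using K by (intro mult_right_mono) (auto simp: w_def)
    then have w2: "w * K\<^sup>2 \<le> \<eta> / 2" using K by simp
    have "w * \<eta> \<le> 1 / \<eta> * \<eta>" using \<eta> by (intro mult_right_mono) (auto simp: w_def)
    then have w3: "w * \<eta> \<le> 1" using \<eta> by simp
    show "\<exists>c \<beta>. c > 0 \<and> \<beta> > 0 \<and> (\<forall>V\<ge>1. \<forall>x U. qla_run M F S N V x U \<longrightarrow>
        (\<forall>m\<ge>0. deviation_freq M U (U_star N p V) D m \<le> ereal (c * exp (- \<beta> * m))))"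
    proof (intro exI conjI allI impI)
      show "0 < 2 * exp (w * K) / (w * \<eta>)" "0 < w" using w \<eta> by simp_all
      fix V x U m assume "1 \<le> V" and run: "qla_run M F S N V x U"
      then have "AE \<omega> in M. D \<le> norm (U t \<omega> - U_star N p V) \<longrightarrow>
        cond_expect_given M borel (U t) (\<lambda>\<omega>. norm (U (t + ?k) \<omega> - U_star N p V)) \<omega>
          \<le> norm (U t \<omega> - U_star N p V) - \<eta>" for t
        using drift by (auto simp: drift_condition_def)
      from deviation_freq_bound[OF run T_pos[OF \<nu>] this w w1[unfolded K_def] w2[unfolded K_def] w3 \<eta>]
      show "deviation_freq M U (U_star N p V) D m \<le> ereal (2 * exp (w * K) / (w * \<eta>) * exp (- w * m))"
        by (simp add: K_def)
    qed
  qed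
  from ex explicit tail show ?thesis by blast
qed

end
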